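(* Let $\mathcal{A}\subseteq\mathcal{B}(\mathcal{H}_1)$ and $\mathcal{B}\subseteq\mathcal{B}(\mathcal{H}_2)$ be reflexive algebras, let $\mathcal{U}\subseteq\mathcal{B}(\mathcal{H}_1,\mathcal{H}_2)$ be a w*-closed normalizing space, and let $\chi=\operatorname{Map}\mathcal{U}$. The following are equivalent: (1) $\mathcal{U}\subseteq SN(\mathcal{B},\mathcal{A})$. (2) (i) $\chi(L)\perp\chi(L^\perp)$ for each $L\in\operatorname{Lat}\mathcal{A}$, and (ii) $\chi_o(\operatorname{Lat}\mathcal{A}_o)\subseteq\operatorname{Lat}\mathcal{B}_o$. (3) (i) $\chi(L)\perp\chi(L^\perp)$ for each $L\in\operatorname{Lat}\mathcal{A}$, and (ii) for each $L\in\operatorname{Lat}\mathcal{A}$ there exists a projection $Q$ (on $\mathcal{K}_2^\perp$) such that $\overline{[\mathcal{B}\chi(L)]}=\chi(L)|_{\mathcal{K}_2}\oplus Q$ with respect to $\mathcal{H}_2=\mathcal{K}_2\oplus\mathcal{K}_2^\perp$.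
   Context: All Hilbert spaces are complex and separable; $P^\perp=I-P$ for a projection $P$. For a set $\mathcal{X}$ of operators on a Hilbert space, $\operatorname{Lat}\mathcal{X}$ is the lattice of projections $L$ with $L^\perp XL=0$ for all $X\in\mathcal{X}$. Reflexive algebras are unital algebras $\mathcal{A}$ with $\mathcal{A}=\{A:L^\perp AL=0\ \forall L\in\operatorname{Lat}\mathcal{A}\}$. $SN(\mathcal{B},\mathcal{A})=\{T\in\mathcal{B}(\mathcal{H}_1,\mathcal{H}_2):T^*\mathcal{B}T\subseteq\mathcal{A}\}$. A linear subspace $\mathcal{U}$ is normalizing if $AB^*C\in\mathcal{U}$ for all $A,B,C\in\mathcal{U}$. The map $\operatorname{Map}\mathcal{U}$ sends a projection $P$ on the domain space to the projection onto the closed linear span of $\{Sx:S\in\mathcal{U},x\in\operatorname{ran}P\}$. $\overline{[\mathcal{B}\chi(L)]}$ is the projection onto the closed linear span of $\{By:B\in\mathcal{B},y\in\chi(L)(\mathcal{H}_2)\}$. Let $\mathcal{K}_1$ be the closed linear span of $\mathcal{U}^*(\mathcal{H}_2)$ (equivalently $0_+^\perp\mathcal{H}_1$ where $0_+=\bigvee\{P:\chi(P)=0\}$) and $\mathcal{K}_2$ the closed linear span of $\mathcal{U}(\mathcal{H}_1)$ (the range of $\chi(I)$). $\mathcal{A}_o$ (resp. $\mathcal{B}_o$) denotes the compression of $\mathcal{A}$ to $\mathcal{K}_1$ (resp. of $\mathcal{B}$ to $\mathcal{K}_2$), $\mathcal{U}_o\subseteq\mathcal{B}(\mathcal{K}_1,\mathcal{K}_2)$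 the restriction of $\mathcal{U}$ to $\mathcal{K}_1$, and $\chi_o=\operatorname{Map}\mathcal{U}_o$. *)

theory Defs
  imports "HOL-Analysis.Analysis" "HOL-Library.FuncSet"
begin

text \<open>The norm axiom makes the inner product positive definite and ties it to the
  complete metric of the class banach.  The inner product is linear in its first argument.\<close>

class complex_hilbert = banach +
  fixes scaleC :: "complex \<Rightarrow> 'a \<Rightarrow> 'a" (infixr \<open>*\<^sub>C\<close> 75)
    and cinner :: "'a \<Rightarrow> 'a \<Rightarrow> complex"
  assumes scaleC_add_right: "a *\<^sub>C (x + y) = a *\<^sub>C x + a *\<^sub>C y"
    and scaleC_add_left: "(a + b) *\<^sub>C x = a *\<^sub>C x + b *\<^sub>C x"
    and scaleC_scaleC: "a *\<^sub>C (b *\<^sub>C x) = (a * b) *\<^sub>C x"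
    and scaleC_of_real: "complex_of_real r *\<^sub>C x = r *\<^sub>R x"
    and cinner_add_left: "cinner (x + y) z = cinner x z + cinner y z"
    and cinner_scaleC_left: "cinner (a *\<^sub>C x) y = a * cinner x y"
    and cinner_commute: "cinner x y = cnj (cinner y x)"
    and norm_eq_sqrt_cinner: "norm x = sqrt (Re (cinner x x))"

class separable_complex_hilbert = complex_hilbert +
  assumes separable: "\<exists>D. countable D \<and> (\<forall>x e. 0 < e \<longrightarrow> (\<exists>d\<in>D. dist x d < e))"

instantiation complex :: separable_complex_hilbert
begin

definition scaleC_complex :: "complex \<Rightarrow> complex \<Rightarrow> complex"
  where "scaleC_complex a x = a * x"

definition cinner_complex :: "complex \<Rightarrow> complex \<Rightarrow> complex"
  where "cinner_complex x y = x * cnj y"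

instance
proof
  obtain D :: "complex set" where "countable D"
    and D: "\<And>X. open X \<Longrightarrow> X \<noteq> {} \<Longrightarrow> \<exists>d\<in>D. d \<in> X"
    by (rule countable_dense_setE) blast
  moreover have "\<exists>d\<in>D. dist x d < e" if "0 < e" for x e
    using D[of "ball x e"] that by auto
  ultimately show "\<exists>D::complex set. countable D \<and> (\<forall>x e. 0 < e \<longrightarrow> (\<exists>d\<in>D. dist x d < e))"
    by blast
qed (auto simp: scaleC_complex_def cinner_complex_def algebra_simps scaleR_conv_of_real
      cmod_def power2_eq_square)

end

global_interpretation complex_vector:
  vector_space "scaleC :: complex \<Rightarrow> 'a \<Rightarrow> 'a::complex_hilbert"
  defines csubspace = complex_vector.subspace
    and cspan = complex_vector.span
proof
  fix x :: 'a
  show "1 *\<^sub>C x = x"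
    using scaleC_of_real[of 1 x] by simp
qed (simp_all add: scaleC_add_right scaleC_add_left scaleC_scaleC)

text \<open>A Hilbert space is given by a carrier: a closed complex subspace \<open>H\<close> of a type of class
  complex_hilbert (so \<open>UNIV\<close> is the whole space).  This allows operators on subspaces such as
  \<open>K\<^sub>1\<close> to be compared with operators on the whole space.  An operator with domain \<open>H\<close> is an
  extensional function on \<open>H\<close>; when \<open>H = UNIV\<close> this is no restriction.\<close>

definition bounded_ops :: "'a::complex_hilbert set \<Rightarrow> 'b::complex_hilbert set \<Rightarrow> ('a \<Rightarrow> 'b) set"
  where "bounded_ops H K = {T \<in> H \<rightarrow>\<^sub>E K.
    (\<forall>x\<in>H. \<forall>y\<in>H. T (x + y) = T x + T y) \<and>
    (\<forall>c. \<forall>x\<in>H. T (c *\<^sub>C x) = c *\<^sub>C T x) \<and>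
    (\<exists>M. \<forall>x\<in>H. norm (T x) \<le> M * norm x)}"

definition adj ::
    "'a::complex_hilbert set \<Rightarrow> 'b::complex_hilbert set \<Rightarrow> ('a \<Rightarrow> 'b) \<Rightarrow> ('b \<Rightarrow> 'a)"
  where "adj H K T =
    (THE S. S \<in> bounded_ops K H \<and> (\<forall>x\<in>H. \<forall>y\<in>K. cinner (T x) y = cinner x (S y)))"

definition op_subspace ::
    "'a::complex_hilbert set \<Rightarrow> 'b::complex_hilbert set \<Rightarrow> ('a \<Rightarrow> 'b) set \<Rightarrow> bool"
  where "op_subspace H K U \<longleftrightarrow> U \<subseteq> bounded_ops H K \<and>
    (\<lambda>x\<in>H. 0) \<in> U \<and>
    (\<forall>S\<in>U. \<forall>T\<in>U. (\<lambda>x\<in>H. S x + T x) \<in> U) \<and>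
    (\<forall>c. \<forall>T\<in>U. (\<lambda>x\<in>H. c *\<^sub>C T x) \<in> U)"

definition projections :: "'a::complex_hilbert set \<Rightarrow> ('a \<Rightarrow> 'a) set"
  where "projections H = {P \<in> bounded_ops H H. compose H P P = P \<and> adj H H P = P}"

definition perp :: "'a::complex_hilbert set \<Rightarrow> ('a \<Rightarrow> 'a) \<Rightarrow> ('a \<Rightarrow> 'a)"
  where "perp H P = (\<lambda>x\<in>H. x - P x)"

definition orthogonal_projections ::
    "'a::complex_hilbert set \<Rightarrow> ('a \<Rightarrow> 'a) \<Rightarrow> ('a \<Rightarrow> 'a) \<Rightarrow> bool"
  where "orthogonal_projections H P Q \<longleftrightarrow> compose H P Q = (\<lambda>x\<in>H. 0)"

definition proj_onto :: "'a::complex_hilbert set \<Rightarrow> 'a set \<Rightarrow> ('a \<Rightarrow> 'a)"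
  where "proj_onto H M = (THE P. P \<in> projections H \<and> P ` H = M)"

definition closed_cspan :: "'a::complex_hilbert set \<Rightarrow> 'a set"
  where "closed_cspan X = closure (cspan X)"

definition orth_compl :: "'a::complex_hilbert set \<Rightarrow> 'a set \<Rightarrow> 'a set"
  where "orth_compl H M = {x \<in> H. \<forall>y\<in>M. cinner x y = 0}"

text \<open>The \<open>w\<^sup>*\<close>-topology of \<open>B(H,K)\<close> as the dual of the trace class operators: it is the weakest
  topology making continuous the functionals \<open>T \<mapsto> \<Sum>n. \<langle>T x\<^sub>n, y\<^sub>n\<rangle>\<close> with square-summable
  \<open>(\<parallel>x\<^sub>n\<parallel>)\<close> and \<open>(\<parallel>y\<^sub>n\<parallel>)\<close>.\<close>

definition wstar_topology ::
    "'a::complex_hilbert set \<Rightarrow> 'b::complex_hilbert set \<Rightarrow> ('a \<Rightarrow> 'b) topology"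
  where "wstar_topology H K = topology_generated_by
    {{T \<in> bounded_ops H K. (\<Sum>n. cinner (T (x n)) (y n)) \<in> W} | x y W.
      range x \<subseteq> H \<and> summable (\<lambda>n. (norm (x n))\<^sup>2) \<and>
      range y \<subseteq> K \<and> summable (\<lambda>n. (norm (y n))\<^sup>2) \<and> open W}"

definition Lat :: "'a::complex_hilbert set \<Rightarrow> ('a \<Rightarrow> 'a) set \<Rightarrow> ('a \<Rightarrow> 'a) set"
  where "Lat H \<X> = {L \<in> projections H.
    \<forall>X\<in>\<X>. compose H (perp H L) (compose H X L) = (\<lambda>x\<in>H. 0)}"

definition unital_algebra :: "'a::complex_hilbert set \<Rightarrow> ('a \<Rightarrow> 'a) set \<Rightarrow> bool"
  where "unital_algebra H \<A> \<longleftrightarrow> op_subspace H H \<A> \<and>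
    (\<lambda>x\<in>H. x) \<in> \<A> \<and> (\<forall>S\<in>\<A>. \<forall>T\<in>\<A>. compose H S T \<in> \<A>)"

definition reflexive_algebra :: "'a::complex_hilbert set \<Rightarrow> ('a \<Rightarrow> 'a) set \<Rightarrow> bool"
  where "reflexive_algebra H \<A> \<longleftrightarrow> unital_algebra H \<A> \<and>
    \<A> = {A \<in> bounded_ops H H.
      \<forall>L\<in>Lat H \<A>. compose H (perp H L) (compose H A L) = (\<lambda>x\<in>H. 0)}"

definition SN ::
    "'a::complex_hilbert set \<Rightarrow> 'b::complex_hilbert set \<Rightarrow> ('b \<Rightarrow> 'b) set \<Rightarrow> ('a \<Rightarrow> 'a) set
      \<Rightarrow> ('a \<Rightarrow> 'b) set"
  where "SN H K \<B> \<A> = {T \<in> bounded_ops H K.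
    \<forall>B\<in>\<B>. compose H (adj H K T) (compose H B T) \<in> \<A>}"

definition normalizing ::
    "'a::complex_hilbert set \<Rightarrow> 'b::complex_hilbert set \<Rightarrow> ('a \<Rightarrow> 'b) set \<Rightarrow> bool"
  where "normalizing H K U \<longleftrightarrow> op_subspace H K U \<and>
    (\<forall>A\<in>U. \<forall>B\<in>U. \<forall>C\<in>U. compose H A (compose H (adj H K B) C) \<in> U)"

definition op_map ::
    "'a::complex_hilbert set \<Rightarrow> 'b::complex_hilbert set \<Rightarrow> ('a \<Rightarrow> 'b) set
      \<Rightarrow> ('a \<Rightarrow> 'a) \<Rightarrow> ('b \<Rightarrow> 'b)"
  where "op_map H K U P = proj_onto K (closed_cspan {S x | S x. S \<in> U \<and> x \<in> P ` H})"

definition compression :: "'a::complex_hilbert set \<Rightarrow> 'a set \<Rightarrow> ('a \<Rightarrow> 'a) \<Rightarrow> ('a \<Rightarrow> 'a)"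
  where "compression H K A = (\<lambda>x\<in>K. proj_onto H K (A x))"

definition direct_sum ::
    "'a::complex_hilbert set \<Rightarrow> 'a set \<Rightarrow> ('a \<Rightarrow> 'a) \<Rightarrow> ('a \<Rightarrow> 'a) \<Rightarrow> ('a \<Rightarrow> 'a)"
  where "direct_sum H K S Q =
    (\<lambda>x\<in>H. S (proj_onto H K x) + Q (proj_onto H (orth_compl H K) x))"

end

theory Submission
  imports Defs
begin

text \<open>All three conditions become orthogonality relations once projections are replaced by
  their ranges. A projection belongs to \<open>Lat \<A>\<close> if and only if its range is invariant under
  \<open>\<A>\<close>, and by reflexivity an operator belongs to \<open>\<A>\<close> if and only if it leaves every such
  subspace \<open>M\<close> invariant. For an invariant \<open>M\<close> write \<open>I\<close>, \<open>J\<close> and \<open>V\<close> for the closed spans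
  of \<open>U M\<close>, of \<open>U M\<^sup>\<bottom>\<close> and of \<open>\<B> I\<close>; then \<open>I \<subseteq> V\<close>, and \<open>I\<close> and \<open>J\<close> together span \<open>K\<^sub>2\<close>.

  The operator \<open>T\<^sup>* B T\<close> maps \<open>M\<close> into \<open>M\<close> if and only if \<open>B T x\<close> is orthogonal to \<open>T y\<close> for
  all \<open>x \<in> M\<close> and \<open>y \<in> M\<^sup>\<bottom>\<close>. By polarization in the linear space \<open>U\<close> two different operators
  of \<open>U\<close> are allowed here, so the first condition says that \<open>V\<close> is orthogonal to \<open>J\<close> for
  every \<open>M\<close> (\<open>subset_SN_iff\<close>).

  The orthogonality of \<open>\<chi>(L)\<close> and \<open>\<chi>(L\<^sup>\<bottom>)\<close> says that \<open>I\<close> is orthogonal to \<open>J\<close>. When this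
  holds, \<open>V\<close> is orthogonal to \<open>J\<close> if and only if the vectors of \<open>V\<close> differ from their
  projections to \<open>I\<close> by vectors orthogonal to \<open>K\<^sub>2\<close>, that is, if and only if the projection
  onto \<open>V\<close> splits as in the third condition (\<open>orthogonal_iff_direct_sum\<close>).

  For the second condition, first let the operators \<open>T\<^sup>* B S\<close> be in \<open>\<A>\<close>. Then the argument can
  be repeated inside \<open>K\<^sub>1\<close>, for subspaces invariant under the compressed algebra
  (\<open>compression_invariant_span_image\<close>). Conversely, if \<open>I\<close> is orthogonal to \<open>J\<close>, the
  projection onto \<open>K\<^sub>1\<close> maps \<open>M\<close> into \<open>M\<close> (\<open>coinitial_reduces\<close>). As \<open>U\<close> vanishes on the
  orthogonal complement of \<open>K\<^sub>1\<close>, the subspace \<open>M \<inter> K\<^sub>1\<close>, which is invariant under the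
  compressed algebra, has the same image \<open>I\<close>. The second condition then says that the
  projections of the vectors \<open>B y\<close>, \<open>y \<in> I\<close>, to \<open>K\<^sub>2\<close> stay in \<open>I\<close>, and this gives the
  orthogonality of \<open>B y\<close> to \<open>J \<subseteq> K\<^sub>2\<close>.\<close>

section \<open>Complex Hilbert spaces\<close>

lemma cinner_add_right: "cinner x (y + z) = cinner x y + cinner x z"
  by (metis cinner_add_left cinner_commute complex_cnj_add)

lemma cinner_scaleC_right: "cinner x (a *\<^sub>C y) = cnj a * cinner x y"
  by (metis cinner_scaleC_left cinner_commute complex_cnj_mult)

lemma cinner_zero_left [simp]: "cinner 0 x = 0"
  by (metis add_cancel_right_left cinner_add_left)

lemma cinner_zero_right [simp]: "cinner x 0 = 0"
  by (metis add_cancel_right_left cinner_add_right)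

lemma cinner_diff_left: "cinner (x - y) z = cinner x z - cinner y z"
  by (metis add_diff_cancel cinner_add_left diff_add_cancel)

lemma cinner_diff_right: "cinner x (y - z) = cinner x y - cinner x z"
  by (metis add_diff_cancel cinner_add_right diff_add_cancel)

lemma cinner_minus_right: "cinner x (- y) = - cinner x y"
  by (metis cinner_diff_right cinner_zero_right diff_0)

lemmas cinner_simps = cinner_add_left cinner_add_right cinner_scaleC_left cinner_scaleC_right
  cinner_diff_left cinner_diff_right

lemma cinner_zero_commute: "cinner x y = 0 \<longleftrightarrow> cinner y x = 0"
  by (metis cinner_commute complex_cnj_zero)

lemma Re_cinner_self: "Re (cinner x x) = (norm x)\<^sup>2"
  by (metis norm_eq_sqrt_cinner norm_ge_zero real_sqrt_ge_0_iff real_sqrt_pow2)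

lemma cinner_self: "cinner x x = complex_of_real ((norm x)\<^sup>2)"
proof -
  have "Im (cinner x x) = 0"
    using arg_cong[OF cinner_commute[of x x], of Im] by simp
  then show ?thesis
    by (simp add: complex_eq_iff Re_cinner_self del: of_real_power)
qed

lemma cinner_self_eq_0 [simp]: "cinner x x = 0 \<longleftrightarrow> x = 0"
  by (simp add: cinner_self)

lemma norm_add_sq: "(norm (x + y))\<^sup>2 = (norm x)\<^sup>2 + 2 * Re (cinner x y) + (norm y)\<^sup>2"
proof -
  have "Re (cinner y x) = Re (cinner x y)"
    by (subst cinner_commute) simp
  then show ?thesis
    by (simp add: Re_cinner_self[symmetric] cinner_simps)
qed

lemma parallelogram_law:
  fixes x y :: "'a::complex_hilbert"
  shows "(norm (x - y))\<^sup>2 + (norm (x + y))\<^sup>2 = 2 * (norm x)\<^sup>2 + 2 * (norm y)\<^sup>2"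
  using norm_add_sq[of x y] norm_add_sq[of x "- y"] by (simp add: cinner_minus_right)

lemma norm_scaleC: "norm (a *\<^sub>C x) = cmod a * norm x"
proof -
  have "cinner (a *\<^sub>C x) (a *\<^sub>C x) = (a * cnj a) * cinner x x"
    by (simp add: cinner_simps)
  also have "\<dots> = complex_of_real ((cmod a * norm x)\<^sup>2)"
    by (simp add: cinner_self complex_norm_square[symmetric] power_mult_distrib)
  finally have "(norm (a *\<^sub>C x))\<^sup>2 = (cmod a * norm x)\<^sup>2"
    by (metis Re_cinner_self Re_complex_of_real)
  then show ?thesis
    by (simp add: power2_eq_iff_nonneg)
qed

text \<open>The norm is assumed to satisfy the triangle inequality, which is the inequality for the
  real part; a rotation of one argument makes the inner product real.\<close>

lemma cinner_le_norm: "cmod (cinner x y) \<le> norm x * norm y"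
proof -
  have Re_le: "Re (cinner u v) \<le> norm u * norm v" for u v :: 'a
  proof -
    have "(norm (u + v))\<^sup>2 \<le> (norm u + norm v)\<^sup>2"
      by (intro power_mono norm_triangle_ineq norm_ge_zero)
    then show ?thesis
      unfolding norm_add_sq by (simp add: power2_sum)
  qed
  show ?thesis
  proof (cases "cinner x y = 0")
    case False
    define a where "a = cnj (cinner x y) / complex_of_real (cmod (cinner x y))"
    have "cinner (a *\<^sub>C x) y = complex_of_real (cmod (cinner x y))"
      using False unfolding a_def cinner_scaleC_left
      using complex_norm_square[of "cinner x y"]
      by (simp add: field_simps power2_eq_square)
    moreover have "cmod a = 1"
      using False by (simp add: a_def norm_divide)
    ultimately show ?thesis
      using Re_le[of "a *\<^sub>C x" y] by (simp add: norm_scaleC)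
  qed simp
qed

lemma scaleR_eq_scaleC: "r *\<^sub>R x = complex_of_real r *\<^sub>C x"
  by (simp add: scaleC_of_real)

lemma bounded_linear_cinner_left: "bounded_linear (\<lambda>x. cinner x y)"
proof (rule bounded_linear_intro[where K = "norm y"])
  show "cinner (r *\<^sub>R x) y = r *\<^sub>R cinner x y" for r x
    unfolding scaleR_conv_of_real by (simp add: scaleR_eq_scaleC cinner_scaleC_left)
qed (simp_all add: cinner_simps cinner_le_norm)

lemma bounded_linear_scaleC: "bounded_linear (\<lambda>x. a *\<^sub>C x)"
proof (rule bounded_linear_intro[where K = "cmod a"])
  show "a *\<^sub>C (r *\<^sub>R x) = r *\<^sub>R (a *\<^sub>C x)" for r x
    by (simp add: scaleR_eq_scaleC scaleC_scaleC mult.commute)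
qed (simp_all add: scaleC_add_right norm_scaleC mult.commute)

section \<open>Closed subspaces and orthogonality\<close>

definition closed_csubspace :: "'a::complex_hilbert set \<Rightarrow> bool"
  where "closed_csubspace M \<longleftrightarrow> csubspace M \<and> closed M"

lemma closed_csubspaceD:
  assumes "closed_csubspace M"
  shows "0 \<in> M" "x \<in> M \<Longrightarrow> y \<in> M \<Longrightarrow> x + y \<in> M" "x \<in> M \<Longrightarrow> y \<in> M \<Longrightarrow> x - y \<in> M"
    "x \<in> M \<Longrightarrow> c *\<^sub>C x \<in> M" "closed M"
  using assms unfolding closed_csubspace_def
  by (auto intro: complex_vector.subspace_0 complex_vector.subspace_add
      complex_vector.subspace_diff complex_vector.subspace_scale)

lemma closed_csubspaceI:
  assumes "0 \<in> M" "\<And>x y. x \<in> M \<Longrightarrow> y \<in> M \<Longrightarrow> x + y \<in> M" "\<And>c x. x \<in> M \<Longrightarrow> c *\<^sub>C x \<in> M" "closed M"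
  shows "closed_csubspace M"
  using assms unfolding closed_csubspace_def complex_vector.subspace_def by blast

lemma closed_csubspace_UNIV: "closed_csubspace UNIV"
  by (rule closed_csubspaceI) auto

lemma closed_csubspace_Int:
  "closed_csubspace M \<Longrightarrow> closed_csubspace N \<Longrightarrow> closed_csubspace (M \<inter> N)"
  by (auto simp: closed_csubspace_def complex_vector.subspace_inter)

lemma closed_csubspace_annihilator: "closed_csubspace {x. cinner x y = 0}"
proof (rule closed_csubspaceI)
  show "closed {x. cinner x y = 0}"
    by (intro closed_Collect_eq continuous_on_const
        linear_continuous_on bounded_linear_cinner_left)
qed (auto simp: cinner_simps)

lemma closed_csubspace_orth_compl:
  assumes "closed_csubspace H"
  shows "closed_csubspace (orth_compl H M)"
proof (rule closed_csubspaceI)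
  have "orth_compl H M = H \<inter> (\<Inter>y\<in>M. {x. cinner x y = 0})"
    by (auto simp: orth_compl_def)
  then show "closed (orth_compl H M)"
    using closed_csubspaceD(5)[OF assms] closed_csubspaceD(5)[OF closed_csubspace_annihilator]
    by (auto intro!: closed_INT closed_Int)
qed (use closed_csubspaceD[OF assms] in \<open>auto simp: orth_compl_def cinner_simps\<close>)

lemma closure_csubspace:
  assumes "csubspace M"
  shows "closed_csubspace (closure M)"
proof (rule closed_csubspaceI)
  show "0 \<in> closure M"
    using assms complex_vector.subspace_0 closure_subset by blast
  show "x + y \<in> closure M" if x: "x \<in> closure M" and y: "y \<in> closure M" for x y
  proof -
    from x y obtain f g where "\<And>n::nat. f n \<in> M" "f \<longlonglongrightarrow> x" "\<And>n::nat. g n \<in> M" "g \<longlonglongrightarrow> y"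
      unfolding closure_sequential by blast
    then show ?thesis
      unfolding closure_sequential
      by (intro exI[of _ "\<lambda>n. f n + g n"])
        (auto intro: tendsto_add complex_vector.subspace_add[OF assms])
  qed
  show "c *\<^sub>C x \<in> closure M" if "x \<in> closure M" for c x
  proof -
    have "(\<lambda>x. c *\<^sub>C x) ` closure M \<subseteq> closure ((\<lambda>x. c *\<^sub>C x) ` M)"
      by (rule closure_bounded_linear_image_subset[OF bounded_linear_scaleC])
    also have "\<dots> \<subseteq> closure M"
      using assms complex_vector.subspace_scale by (intro closure_mono) auto
    finally show ?thesis
      using that by blast
  qed
qed simp

lemma closed_csubspace_closed_cspan: "closed_csubspace (closed_cspan X)"
  unfolding closed_cspan_def by (intro closure_csubspace complex_vector.subspace_span)

lemma closed_cspan_superset: "X \<subseteq> closed_cspan X"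
  unfolding closed_cspan_def using closure_subset complex_vector.span_superset by blast

lemma closed_cspan_minimal: "X \<subseteq> M \<Longrightarrow> closed_csubspace M \<Longrightarrow> closed_cspan X \<subseteq> M"
  unfolding closed_cspan_def closed_csubspace_def
  by (intro closure_minimal complex_vector.span_minimal) auto

lemma closed_cspan_mono: "X \<subseteq> Y \<Longrightarrow> closed_cspan X \<subseteq> closed_cspan Y"
  by (meson closed_cspan_minimal closed_cspan_superset closed_csubspace_closed_cspan subset_trans)

definition orthogonal_sets :: "'a::complex_hilbert set \<Rightarrow> 'a set \<Rightarrow> bool"
  where "orthogonal_sets X Y \<longleftrightarrow> (\<forall>x\<in>X. \<forall>y\<in>Y. cinner x y = 0)"

lemma orthogonal_setsD: "orthogonal_sets X Y \<Longrightarrow> x \<in> X \<Longrightarrow> y \<in> Y \<Longrightarrow> cinner x y = 0"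
  by (simp add: orthogonal_sets_def)

lemma orthogonal_sets_commute: "orthogonal_sets X Y \<longleftrightarrow> orthogonal_sets Y X"
  unfolding orthogonal_sets_def using cinner_zero_commute by blast

lemma orthogonal_closed_cspan_left [simp]:
  "orthogonal_sets (closed_cspan X) Y \<longleftrightarrow> orthogonal_sets X Y"
proof
  assume "orthogonal_sets X Y"
  then have "X \<subseteq> {x. cinner x y = 0}" if "y \<in> Y" for y
    using that by (auto simp: orthogonal_sets_def)
  then show "orthogonal_sets (closed_cspan X) Y"
    unfolding orthogonal_sets_def
    using closed_cspan_minimal[OF _ closed_csubspace_annihilator] by blast
qed (use closed_cspan_superset in \<open>auto simp: orthogonal_sets_def\<close>)

lemma orthogonal_closed_cspan_right [simp]:
  "orthogonal_sets X (closed_cspan Y) \<longleftrightarrow> orthogonal_sets X Y"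
  by (metis orthogonal_sets_commute orthogonal_closed_cspan_left)

text \<open>A minimizing sequence for the distance from \<open>x\<close> to \<open>M\<close> is a Cauchy sequence by the
  parallelogram law, because the midpoints of its terms lie in \<open>M\<close> as well.\<close>

lemma nearest_point_exists:
  assumes M: "closed_csubspace M"
  shows "\<exists>m\<in>M. \<forall>y\<in>M. norm (x - m) \<le> norm (x - y)"
proof -
  define d where "d = (INF y\<in>M. norm (x - y))"
  have "M \<noteq> {}"
    using closed_csubspaceD(1)[OF M] by blast
  have bdd: "bdd_below ((\<lambda>y. norm (x - y)) ` M)"
    by (rule bdd_belowI2[of _ 0]) simp
  have d_le: "d \<le> norm (x - y)" if "y \<in> M" for y
    unfolding d_def using that by (intro cINF_lower bdd)
  have "0 \<le> d"
    unfolding d_def using \<open>M \<noteq> {}\<close> by (intro cINF_greatest) auto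
  have "\<exists>y\<in>M. norm (x - y) < d + inverse (Suc n)" for n
    using cINF_less_iff[OF \<open>M \<noteq> {}\<close> bdd, of "d + inverse (Suc n)"] by (simp add: d_def)
  then obtain f where fM: "\<And>n. f n \<in> M" and f_less: "\<And>n. norm (x - f n) < d + inverse (Suc n)"
    by metis
  have parallelogram: "(norm (f m - f n))\<^sup>2 \<le>
      2 * (norm (x - f m))\<^sup>2 + 2 * (norm (x - f n))\<^sup>2 - 4 * d\<^sup>2" for m n
  proof -
    have "(norm (f m - f n))\<^sup>2 + (norm ((x - f m) + (x - f n)))\<^sup>2
        = 2 * (norm (x - f m))\<^sup>2 + 2 * (norm (x - f n))\<^sup>2"
      using parallelogram_law[of "x - f m" "x - f n"] by (simp add: norm_minus_commute)
    moreover have "2 * d \<le> norm ((x - f m) + (x - f n))"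
    proof -
      have "(1/2::complex) *\<^sub>C (f m + f n) \<in> M"
        using closed_csubspaceD[OF M] fM by blast
      moreover have "(1/2::complex) *\<^sub>C (f m + f n) = (1/2::real) *\<^sub>R (f m + f n)"
        by (simp add: scaleR_eq_scaleC)
      ultimately have "d \<le> norm (x - (1/2::real) *\<^sub>R (f m + f n))"
        using d_le by metis
      also have "x - (1/2::real) *\<^sub>R (f m + f n) = (1/2::real) *\<^sub>R ((x - f m) + (x - f n))"
        by (simp add: algebra_simps flip: scaleR_2)
      finally show ?thesis
        by simp
    qed
    then have "(2 * d)\<^sup>2 \<le> (norm ((x - f m) + (x - f n)))\<^sup>2"
      using \<open>0 \<le> d\<close> by (intro power_mono) auto
    ultimately show ?thesis
      by (simp add: power_mult_distrib)
  qed
  have lim: "(\<lambda>n. norm (x - f n)) \<longlonglongrightarrow> d"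
  proof (rule tendsto_sandwich[OF _ _ tendsto_const])
    show "(\<lambda>n. d + inverse (real (Suc n))) \<longlonglongrightarrow> d"
      using LIMSEQ_inverse_real_of_nat tendsto_add[OF tendsto_const[of d]] by fastforce
  qed (use d_le fM less_imp_le[OF f_less] in \<open>auto intro: always_eventually\<close>)
  have "Cauchy f"
  proof (rule metric_CauchyI)
    fix e :: real assume "0 < e"
    have "(\<lambda>n. (norm (x - f n))\<^sup>2) \<longlonglongrightarrow> d\<^sup>2"
      by (intro tendsto_power lim)
    then have "\<forall>\<^sub>F n in sequentially. (norm (x - f n))\<^sup>2 < d\<^sup>2 + e\<^sup>2 / 4"
      by (rule order_tendstoD(2)) (use \<open>0 < e\<close> in simp)
    then obtain N where N: "\<And>n. n \<ge> N \<Longrightarrow> (norm (x - f n))\<^sup>2 < d\<^sup>2 + e\<^sup>2 / 4"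
      unfolding eventually_sequentially by blast
    have "dist (f m) (f n) < e" if "m \<ge> N" "n \<ge> N" for m n
    proof -
      have "(norm (f m - f n))\<^sup>2 < e\<^sup>2"
        using parallelogram[of m n] N[OF that(1)] N[OF that(2)] by argo
      then show ?thesis
        using \<open>0 < e\<close> by (simp add: dist_norm power_less_imp_less_base)
    qed
    then show "\<exists>N. \<forall>m\<ge>N. \<forall>n\<ge>N. dist (f m) (f n) < e"
      by blast
  qed
  then obtain m where m: "f \<longlonglongrightarrow> m"
    using Cauchy_convergent convergent_def by blast
  have "m \<in> M"
    using closed_sequentially[OF closed_csubspaceD(5)[OF M]] fM m by blast
  moreover have "norm (x - m) = d"
    using LIMSEQ_unique[OF tendsto_norm[OF tendsto_diff[OF tendsto_const m]] lim] .
  ultimately show ?thesis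
    using d_le by blast
qed

theorem orthogonal_decomposition:
  assumes M: "closed_csubspace M"
  shows "\<exists>m\<in>M. \<forall>y\<in>M. cinner (x - m) y = 0"
proof -
  obtain m where m: "m \<in> M" and min: "\<And>y. y \<in> M \<Longrightarrow> norm (x - m) \<le> norm (x - y)"
    using nearest_point_exists[OF M] by blast
  have "cinner (x - m) y = 0" if "y \<in> M" for y
  proof (cases "y = 0")
    case False
    define c where "c = cinner (x - m) y"
    define t where "t = - c / complex_of_real ((norm y)\<^sup>2)"
    \<comment> \<open>moving \<open>m\<close> along \<open>y\<close> to the foot of the perpendicular shortens the distance by the
      component of \<open>x - m\<close> along \<open>y\<close>\<close>
    have "norm (x - m) \<le> norm (x - m + t *\<^sub>C y)"
    proof -
      have "m - t *\<^sub>C y \<in> M"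
        using closed_csubspaceD[OF M] m that by blast
      from min[OF this] show ?thesis
        by (simp add: algebra_simps)
    qed
    then have "(norm (x - m))\<^sup>2 \<le> (norm (x - m + t *\<^sub>C y))\<^sup>2"
      by (intro power_mono) auto
    then have "0 \<le> 2 * Re (cnj t * c) + (cmod t * norm y)\<^sup>2"
      unfolding norm_add_sq by (simp add: cinner_simps norm_scaleC c_def)
    moreover have "cnj t * c = - complex_of_real ((cmod c)\<^sup>2 / (norm y)\<^sup>2)"
      unfolding t_def using complex_norm_square[of c] by (simp add: mult.commute)
    moreover have "(cmod t * norm y)\<^sup>2 = (cmod c)\<^sup>2 / (norm y)\<^sup>2"
      using False unfolding t_def
      by (simp add: norm_divide norm_power power_mult_distrib power_divide)
        (simp add: field_simps power2_eq_square power4_eq_xxxx)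
    ultimately have "(cmod c)\<^sup>2 / (norm y)\<^sup>2 \<le> 0"
      by simp
    then have "(cmod c)\<^sup>2 \<le> 0"
      using False by (simp add: divide_le_0_iff)
    then show ?thesis
      by (simp add: c_def)
  qed simp
  then show ?thesis
    using m by blast
qed

lemma orth_compl_orth_compl:
  assumes M: "closed_csubspace M" and "M \<subseteq> H" "closed_csubspace H"
  shows "orth_compl H (orth_compl H M) = M"
proof
  show "orth_compl H (orth_compl H M) \<subseteq> M"
  proof
    fix x assume x: "x \<in> orth_compl H (orth_compl H M)"
    obtain m where m: "m \<in> M" "\<forall>y\<in>M. cinner (x - m) y = 0"
      using orthogonal_decomposition[OF M] by blast
    have "x - m \<in> orth_compl H M"
      using m x assms closed_csubspaceD(3)[OF assms(3)] by (auto simp: orth_compl_def)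
    then have "cinner x (x - m) = 0" "cinner m (x - m) = 0"
      using x m cinner_zero_commute by (auto simp: orth_compl_def)
    then have "cinner (x - m) (x - m) = 0"
      by (simp add: cinner_diff_left)
    then show "x \<in> M"
      using m by simp
  qed
  show "M \<subseteq> orth_compl H (orth_compl H M)"
    using assms cinner_zero_commute by (fastforce simp: orth_compl_def)
qed

section \<open>Bounded operators and adjoints\<close>

lemma bounded_opsD:
  assumes "T \<in> bounded_ops H K"
  shows "x \<in> H \<Longrightarrow> T x \<in> K" "x \<in> H \<Longrightarrow> y \<in> H \<Longrightarrow> T (x + y) = T x + T y"
    "x \<in> H \<Longrightarrow> T (c *\<^sub>C x) = c *\<^sub>C T x" "T \<in> extensional H"
  using assms unfolding bounded_ops_def by (auto simp: PiE_iff)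

lemma bounded_ops_diff:
  assumes "T \<in> bounded_ops UNIV K"
  shows "T (x - y) = T x - T y"
  using bounded_opsD(2)[OF assms, of "x - y" y] by simp

lemma bounded_ops_bound:
  assumes "T \<in> bounded_ops H K"
  obtains M where "0 \<le> M" "\<And>x. x \<in> H \<Longrightarrow> norm (T x) \<le> M * norm x"
proof -
  obtain M where M: "\<And>x. x \<in> H \<Longrightarrow> norm (T x) \<le> M * norm x"
    using assms unfolding bounded_ops_def by blast
  have "norm (T x) \<le> max 0 M * norm x" if "x \<in> H" for x
    using M[OF that] mult_right_mono[of M "max 0 M" "norm x"] by simp
  then show thesis
    using that[of "max 0 M"] by simp
qed

lemma bounded_opsI:
  assumes "\<And>x. x \<in> H \<Longrightarrow> T x \<in> K" "\<And>x y. x \<in> H \<Longrightarrow> y \<in> H \<Longrightarrow> T (x + y) = T x + T y"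
    "\<And>c x. x \<in> H \<Longrightarrow> T (c *\<^sub>C x) = c *\<^sub>C T x" "\<And>x. x \<in> H \<Longrightarrow> norm (T x) \<le> M * norm x"
    "T \<in> extensional H"
  shows "T \<in> bounded_ops H K"
  using assms unfolding bounded_ops_def PiE_iff by blast

lemma bounded_ops_compose:
  assumes S: "S \<in> bounded_ops K L" and T: "T \<in> bounded_ops H K" and H: "closed_csubspace H"
  shows "compose H S T \<in> bounded_ops H L"
proof -
  obtain M N where "0 \<le> M" and M: "\<And>x. x \<in> K \<Longrightarrow> norm (S x) \<le> M * norm x"
    and N: "\<And>x. x \<in> H \<Longrightarrow> norm (T x) \<le> N * norm x"
    using bounded_ops_bound[OF S] bounded_ops_bound[OF T] by metis
  have "norm (S (T x)) \<le> M * N * norm x" if "x \<in> H" for x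
    using M[OF bounded_opsD(1)[OF T that]] mult_left_mono[OF N[OF that] \<open>0 \<le> M\<close>] by simp
  then show ?thesis
    using bounded_opsD[OF S] bounded_opsD[OF T] closed_csubspaceD[OF H]
    by (intro bounded_opsI[where M = "M * N"]) (auto simp: compose_def)
qed

lemma eq_if_cinner_eq:
  assumes "closed_csubspace H" "u \<in> H" "v \<in> H" "\<And>x. x \<in> H \<Longrightarrow> cinner x u = cinner x v"
  shows "u = v"
proof -
  have "cinner (u - v) (u - v) = 0"
    using assms closed_csubspaceD(3)[OF assms(1)] cinner_diff_right[of "u - v" u v] by simp
  then show ?thesis
    by simp
qed

text \<open>The orthogonal complement of the kernel of a functional is at most one-dimensional, and
  a suitable multiple of a vector spanning it represents the functional.\<close>

theorem riesz_representation:
  assumes H: "closed_csubspace H"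
    and add: "\<And>x y. x \<in> H \<Longrightarrow> y \<in> H \<Longrightarrow> f (x + y) = f x + f y"
    and scale: "\<And>c x. x \<in> H \<Longrightarrow> f (c *\<^sub>C x) = c * f x"
    and bound: "\<And>x. x \<in> H \<Longrightarrow> cmod (f x) \<le> M * norm x"
  shows "\<exists>z\<in>H. \<forall>x\<in>H. f x = cinner x z"
proof (cases "\<forall>x\<in>H. f x = 0")
  case True
  then show ?thesis
    by (intro bexI[OF _ closed_csubspaceD(1)[OF H]]) simp
next
  case False
  then obtain u where u: "u \<in> H" "f u \<noteq> 0"
    by blast
  have diff: "f (x - y) = f x - f y" if "x \<in> H" "y \<in> H" for x y
    using add[of "x - y" y] closed_csubspaceD(3)[OF H] that by simp
  define N where "N = {x \<in> H. f x = 0}"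
  have N: "closed_csubspace N"
  proof (rule closed_csubspaceI)
    have "f x = 0" if "\<And>n. g n \<in> N" "g \<longlonglongrightarrow> x" "x \<in> H" for g :: "nat \<Rightarrow> 'a" and x
    proof -
      have "(\<lambda>n. M * norm (x - g n)) \<longlonglongrightarrow> M * norm (x - x)"
        by (intro tendsto_intros that)
      moreover have "cmod (f x) \<le> M * norm (x - g n)" for n
        using bound[of "x - g n"] diff[of x "g n"] that closed_csubspaceD(3)[OF H]
        by (auto simp: N_def)
      ultimately have "cmod (f x) \<le> M * norm (x - x)"
        by (intro LIMSEQ_le_const) auto
      then show ?thesis
        by simp
    qed
    moreover have "x \<in> H" if "\<And>n. g n \<in> N" "g \<longlonglongrightarrow> x" for g :: "nat \<Rightarrow> 'a" and x
      using closed_sequentially[OF closed_csubspaceD(5)[OF H] _ that(2)] that(1)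
      by (auto simp: N_def)
    ultimately have "x \<in> N" if "\<And>n. g n \<in> N" "g \<longlonglongrightarrow> x" for g :: "nat \<Rightarrow> 'a" and x
      using that unfolding N_def by blast
    then show "closed N"
      unfolding closed_sequential_limits by blast
  next
    show "0 \<in> N"
      using closed_csubspaceD(1)[OF H] scale[of 0 0] by (simp add: N_def)
  qed (use closed_csubspaceD[OF H] add scale in \<open>auto simp: N_def\<close>)
  obtain m where m: "m \<in> N" "\<forall>y\<in>N. cinner (u - m) y = 0"
    using orthogonal_decomposition[OF N] by blast
  define w where "w = u - m"
  have w: "w \<in> H" "f w \<noteq> 0" "w \<noteq> 0"
    using u m diff closed_csubspaceD[OF H] by (auto simp: w_def N_def)
  define z where "z = cnj (f w / cinner w w) *\<^sub>C w"
  have "f x = cinner x z" if "x \<in> H" for x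
  proof -
    have "x - (f x / f w) *\<^sub>C w \<in> N"
      using that w closed_csubspaceD[OF H] by (simp add: N_def diff scale)
    then have "cinner (x - (f x / f w) *\<^sub>C w) w = 0"
      using m cinner_zero_commute unfolding w_def by blast
    then have "cinner x w = f x / f w * cinner w w"
      by (simp add: cinner_simps)
    then show ?thesis
      using w by (simp add: z_def cinner_simps)
  qed
  moreover have "z \<in> H"
    using w closed_csubspaceD[OF H] by (simp add: z_def)
  ultimately show ?thesis
    by blast
qed

lemma adjoint_exists:
  assumes T: "T \<in> bounded_ops H K" and H: "closed_csubspace H" and K: "closed_csubspace K"
  shows "\<exists>S\<in>bounded_ops K H. \<forall>x\<in>H. \<forall>y\<in>K. cinner (T x) y = cinner x (S y)"
proof -
  obtain M where "0 \<le> M" and M: "\<And>x. x \<in> H \<Longrightarrow> norm (T x) \<le> M * norm x"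
    using bounded_ops_bound[OF T] by metis
  have "\<exists>z\<in>H. \<forall>x\<in>H. cinner (T x) y = cinner x z" if "y \<in> K" for y
  proof (rule riesz_representation[OF H, where M = "M * norm y"])
    show "cmod (cinner (T x) y) \<le> M * norm y * norm x" if "x \<in> H" for x
      using order_trans[OF cinner_le_norm mult_right_mono[OF M[OF that], of "norm y"]]
      by (simp add: mult_ac)
  qed (simp_all add: bounded_opsD[OF T] cinner_simps)
  then obtain S0 where S0: "\<And>y. y \<in> K \<Longrightarrow> S0 y \<in> H"
      "\<And>x y. y \<in> K \<Longrightarrow> x \<in> H \<Longrightarrow> cinner (T x) y = cinner x (S0 y)"
    by metis
  define S where "S = restrict S0 K"
  have S: "S y \<in> H" "x \<in> H \<Longrightarrow> cinner x (S y) = cinner (T x) y" if "y \<in> K" for x y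
    using that by (simp_all add: S_def S0)
  have "S \<in> bounded_ops K H"
  proof (rule bounded_opsI[where M = M])
    show "S (x + y) = S x + S y" if "x \<in> K" "y \<in> K" for x y
      using that closed_csubspaceD[OF H] closed_csubspaceD[OF K]
      by (intro eq_if_cinner_eq[OF H]) (simp_all add: S cinner_add_right)
    show "S (c *\<^sub>C x) = c *\<^sub>C S x" if "x \<in> K" for c x
      using that closed_csubspaceD[OF H] closed_csubspaceD[OF K]
      by (intro eq_if_cinner_eq[OF H]) (simp_all add: S cinner_scaleC_right)
    show "norm (S x) \<le> M * norm x" if "x \<in> K" for x
    proof (cases "S x = 0")
      case False
      have "norm (S x) * norm (S x) = cmod (cinner (T (S x)) x)"
        unfolding S(2)[OF that S(1)[OF that], symmetric] cinner_self
        by (simp add: power2_eq_square norm_mult)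
      also have "\<dots> \<le> norm (T (S x)) * norm x"
        by (rule cinner_le_norm)
      also have "\<dots> \<le> (M * norm (S x)) * norm x"
        by (intro mult_right_mono M S that norm_ge_zero)
      finally have "norm (S x) * norm (S x) \<le> (M * norm x) * norm (S x)"
        by (simp add: mult_ac)
      then show ?thesis
        using False by simp
    qed (simp add: \<open>0 \<le> M\<close>)
  qed (simp_all add: S S_def S0)
  then show ?thesis
    by (rule bexI[rotated]) (simp add: S)
qed

lemma adj_eqI:
  assumes S: "S \<in> bounded_ops K H" and H: "closed_csubspace H"
    and eq: "\<And>x y. x \<in> H \<Longrightarrow> y \<in> K \<Longrightarrow> cinner (T x) y = cinner x (S y)"
  shows "adj H K T = S"
  unfolding adj_def
proof (rule the_equality)
  fix R assume R: "R \<in> bounded_ops K H \<and> (\<forall>x\<in>H. \<forall>y\<in>K. cinner (T x) y = cinner x (R y))"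
  show "R = S"
  proof (rule extensionalityI[of _ K])
    show "R y = S y" if "y \<in> K" for y
    proof (rule eq_if_cinner_eq[OF H])
      show "R y \<in> H" "S y \<in> H"
        using R S that by (auto intro: bounded_opsD(1))
      show "cinner x (R y) = cinner x (S y)" if "x \<in> H" for x
        using R eq that \<open>y \<in> K\<close> by simp
    qed
    show "R \<in> extensional K"
      using R bounded_opsD(4) by blast
    show "S \<in> extensional K"
      by (rule bounded_opsD(4)[OF S])
  qed
qed (use S eq in blast)

lemma
  assumes T: "T \<in> bounded_ops H K" and "closed_csubspace H" "closed_csubspace K"
  shows adj_bounded_ops: "adj H K T \<in> bounded_ops K H"
    and cinner_adj: "x \<in> H \<Longrightarrow> y \<in> K \<Longrightarrow> cinner (T x) y = cinner x (adj H K T y)"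
proof -
  obtain S where S: "S \<in> bounded_ops K H" "\<And>x y. x \<in> H \<Longrightarrow> y \<in> K \<Longrightarrow> cinner (T x) y = cinner x (S y)"
    using adjoint_exists[OF assms] by blast
  have "adj H K T = S"
    by (rule adj_eqI[OF S(1) assms(2) S(2)])
  then show "adj H K T \<in> bounded_ops K H"
    "x \<in> H \<Longrightarrow> y \<in> K \<Longrightarrow> cinner (T x) y = cinner x (adj H K T y)"
    using S by simp_all
qed

section \<open>Projections onto closed subspaces\<close>

definition subspace_in :: "'a::complex_hilbert set \<Rightarrow> 'a set \<Rightarrow> bool"
  where "subspace_in M H \<longleftrightarrow> closed_csubspace M \<and> closed_csubspace H \<and> M \<subseteq> H"

lemma subspace_in_UNIV [simp]: "subspace_in M UNIV \<longleftrightarrow> closed_csubspace M"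
  by (simp add: subspace_in_def closed_csubspace_UNIV)

lemma foot_unique:
  assumes "closed_csubspace M" "m \<in> M" "m' \<in> M"
    "\<And>y. y \<in> M \<Longrightarrow> cinner (x - m) y = 0" "\<And>y. y \<in> M \<Longrightarrow> cinner (x - m') y = 0"
  shows "m = m'"
proof -
  have "m - m' \<in> M"
    using assms closed_csubspaceD(3) by blast
  then have "cinner (x - m' - (x - m)) (m - m') = 0"
    using assms by (subst cinner_diff_left) simp
  then show ?thesis
    by simp
qed

text \<open>The range of a projection \<open>P\<close> is closed because it is the orthogonal complement of
  the vectors \<open>x - P x\<close>.\<close>

lemma projections_range:
  assumes P: "P \<in> projections H" and H: "closed_csubspace H"
  shows "closed_csubspace (P ` H)" "P ` H \<subseteq> H"
    "x \<in> H \<Longrightarrow> y \<in> P ` H \<Longrightarrow> cinner (x - P x) y = 0"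
proof -
  have Pb: "P \<in> bounded_ops H H" and "compose H P P = P" and "adj H H P = P"
    using P unfolding projections_def by blast+
  have PP: "P (P x) = P x" if "x \<in> H" for x
    using fun_cong[OF \<open>compose H P P = P\<close>, of x] that by (simp add: compose_def)
  have sa: "cinner (P x) y = cinner x (P y)" if "x \<in> H" "y \<in> H" for x y
    using cinner_adj[OF Pb H H that] \<open>adj H H P = P\<close> by simp
  note PH = bounded_opsD(1)[OF Pb]
  show "P ` H \<subseteq> H"
    using PH by blast
  show orth: "cinner (x - P x) y = 0" if x: "x \<in> H" and y: "y \<in> P ` H" for x y
  proof -
    obtain z where z: "z \<in> H" "y = P z"
      using y by blast
    have "cinner (x - P x) (P z) = cinner (P (x - P x)) z"
      using x z PH closed_csubspaceD(3)[OF H] by (simp add: sa)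
    also have "P (x - P x) + P (P x) = P x"
      using bounded_opsD(2)[OF Pb, of "x - P x" "P x"] x PH closed_csubspaceD(3)[OF H] by simp
    then have "P (x - P x) = 0"
      using x PP by simp
    finally show ?thesis
      using z by simp
  qed
  have "P ` H = orth_compl H ((\<lambda>x. x - P x) ` H)"
  proof
    show "P ` H \<subseteq> orth_compl H ((\<lambda>x. x - P x) ` H)"
      using orth PH by (auto simp: orth_compl_def cinner_zero_commute[of "P _"])
    show "orth_compl H ((\<lambda>x. x - P x) ` H) \<subseteq> P ` H"
    proof
      fix x assume x: "x \<in> orth_compl H ((\<lambda>x. x - P x) ` H)"
      then have "x \<in> H"
        by (simp add: orth_compl_def)
      have "cinner (x - P x) z = 0" if "z \<in> H" for z
      proof -
        have "cinner x (z - P z) = 0"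
          using x that by (simp add: orth_compl_def)
        then show ?thesis
          using sa[OF \<open>x \<in> H\<close> that] by (simp add: cinner_simps)
      qed
      then have "cinner (x - P x) (x - P x) = 0"
        using \<open>x \<in> H\<close> PH closed_csubspaceD(3)[OF H] by blast
      then have "P x = x"
        by simp
      then show "x \<in> P ` H"
        using \<open>x \<in> H\<close> by (metis imageI)
    qed
  qed
  then show "closed_csubspace (P ` H)"
    using closed_csubspace_orth_compl[OF H] by simp
qed

lemma projection_exists:
  assumes "subspace_in M H"
  shows "\<exists>P\<in>projections H. P ` H = M"
proof -
  have M: "closed_csubspace M" and H: "closed_csubspace H" and MH: "M \<subseteq> H"
    using assms by (simp_all add: subspace_in_def)
  have "\<forall>x. \<exists>m. m \<in> M \<and> (\<forall>y\<in>M. cinner (x - m) y = 0)"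
    using orthogonal_decomposition[OF M] by blast
  then obtain p where p: "\<And>x. p x \<in> M" "\<And>x y. y \<in> M \<Longrightarrow> cinner (x - p x) y = 0"
    by metis
  define P where "P = restrict p H"
  have P: "P x \<in> M" "y \<in> M \<Longrightarrow> cinner (x - P x) y = 0" "P x \<in> H" if "x \<in> H" for x y
    using p that MH by (auto simp: P_def)
  have fix_M: "P m = m" if "m \<in> M" for m
    using that MH P by (intro foot_unique[OF M, where x = m]) auto
  have sa: "cinner (P x) y = cinner x (P y)" if "x \<in> H" "y \<in> H" for x y
  proof -
    have "cinner (P x) (y - P y) = 0" "cinner (x - P x) (P y) = 0"
      using P(2)[OF \<open>y \<in> H\<close> P(1)[OF \<open>x \<in> H\<close>]] P(2)[OF \<open>x \<in> H\<close> P(1)[OF \<open>y \<in> H\<close>]]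
      by (simp_all add: cinner_zero_commute[of "P x"])
    then show ?thesis
      by (simp add: cinner_simps)
  qed
  have Pb: "P \<in> bounded_ops H H"
  proof (rule bounded_opsI[where M = 1])
    show "P (x + y) = P x + P y" if "x \<in> H" "y \<in> H" for x y
    proof (rule foot_unique[OF M, where x = "x + y"])
      show "cinner (x + y - (P x + P y)) z = 0" if "z \<in> M" for z
        using P(2)[OF \<open>x \<in> H\<close> that] P(2)[OF \<open>y \<in> H\<close> that] by (simp add: cinner_simps)
    qed (use that P closed_csubspaceD[OF M] closed_csubspaceD[OF H] in auto)
    show "P (c *\<^sub>C x) = c *\<^sub>C P x" if "x \<in> H" for c x
    proof (rule foot_unique[OF M, where x = "c *\<^sub>C x"])
      show "cinner (c *\<^sub>C x - c *\<^sub>C P x) z = 0" if "z \<in> M" for z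
        using P(2)[OF \<open>x \<in> H\<close> that] by (simp add: cinner_simps)
    qed (use that P closed_csubspaceD[OF M] closed_csubspaceD[OF H] in auto)
    show "norm (P x) \<le> 1 * norm x" if "x \<in> H" for x
    proof -
      have "cinner (P x) (x - P x) = 0"
        using P(2)[OF that P(1)[OF that]] by (simp add: cinner_zero_commute[of "P x"])
      then have "(norm x)\<^sup>2 = (norm (P x))\<^sup>2 + (norm (x - P x))\<^sup>2"
        using norm_add_sq[of "P x" "x - P x"] by simp
      then show ?thesis
        by (simp add: power2_le_imp_le)
    qed
    show "P \<in> extensional H"
      by (simp add: P_def)
  qed (rule P)
  have "compose H P P = P"
    by (rule extensionalityI[OF _ bounded_opsD(4)[OF Pb]]) (simp_all add: compose_def fix_M P)
  moreover have "adj H H P = P"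
    by (rule adj_eqI[OF Pb H sa])
  moreover have "P ` H = M"
    using P(1) fix_M MH by (auto intro!: image_eqI[of _ P])
  ultimately show ?thesis
    using Pb unfolding projections_def by blast
qed

lemma projections_eqI:
  assumes P: "P \<in> projections H" and Q: "Q \<in> projections H" and H: "closed_csubspace H"
    and "P ` H = Q ` H"
  shows "P = Q"
proof (rule extensionalityI[of _ H])
  show "P x = Q x" if "x \<in> H" for x
  proof (rule foot_unique[of "P ` H" _ _ x])
    show "closed_csubspace (P ` H)"
      by (rule projections_range[OF P H])
    show "cinner (x - P x) y = 0" if "y \<in> P ` H" for y
      by (rule projections_range(3)[OF P H \<open>x \<in> H\<close> that])
    show "cinner (x - Q x) y = 0" if "y \<in> P ` H" for y
      using that \<open>P ` H = Q ` H\<close> by (intro projections_range(3)[OF Q H \<open>x \<in> H\<close>]) simp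
    show "P x \<in> P ` H" "Q x \<in> P ` H"
      using that \<open>P ` H = Q ` H\<close> by (metis imageI)+
  qed
qed (use P Q bounded_opsD(4) in \<open>auto simp: projections_def\<close>)

text \<open>The value of a projection at \<open>x\<close> is the only element of its range whose difference from
  \<open>x\<close> is orthogonal to the range. Thus the range determines the projection, and the
  definite description in \<open>proj_onto\<close> is meaningful.\<close>

lemma
  assumes "subspace_in M H"
  shows proj_onto_projections: "proj_onto H M \<in> projections H"
    and proj_onto_image: "proj_onto H M ` H = M"
proof -
  have "\<exists>!P. P \<in> projections H \<and> P ` H = M"
  proof (rule ex_ex1I)
    show "\<exists>P. P \<in> projections H \<and> P ` H = M"
      using projection_exists[OF assms] by blast
    show "P = Q" if "P \<in> projections H \<and> P ` H = M" "Q \<in> projections H \<and> Q ` H = M" for P Q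
      using that assms by (intro projections_eqI[of P H Q]) (auto simp: subspace_in_def)
  qed
  from theI'[OF this] show "proj_onto H M \<in> projections H" "proj_onto H M ` H = M"
    by (simp_all add: proj_onto_def)
qed

lemma projections_eq_proj_onto:
  assumes "P \<in> projections H" "closed_csubspace H"
  shows "subspace_in (P ` H) H" "P = proj_onto H (P ` H)"
proof -
  show "subspace_in (P ` H) H"
    using projections_range[OF assms] assms by (simp add: subspace_in_def)
  then show "P = proj_onto H (P ` H)"
    using assms(1) by (intro projections_eqI[OF _ _ assms(2)])
      (simp_all add: proj_onto_projections proj_onto_image)
qed

lemma proj_onto_extensional: "subspace_in M H \<Longrightarrow> proj_onto H M \<in> extensional H"
  using proj_onto_projections[of M H] bounded_opsD(4) unfolding projections_def by blast

lemma proj_onto_mem: "subspace_in M H \<Longrightarrow> x \<in> H \<Longrightarrow> proj_onto H M x \<in> M"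
  using proj_onto_image[of M H] by blast

lemma proj_onto_orthogonal:
  assumes "subspace_in M H" "x \<in> H" "y \<in> M"
  shows "cinner (x - proj_onto H M x) y = 0"
  using projections_range(3)[OF proj_onto_projections[OF assms(1)], of x y] assms
  by (simp add: proj_onto_image subspace_in_def)

lemma proj_onto_eqI:
  assumes "subspace_in M H" "x \<in> H" "m \<in> M" "\<And>y. y \<in> M \<Longrightarrow> cinner (x - m) y = 0"
  shows "proj_onto H M x = m"
proof (rule foot_unique[of M _ _ x])
  show "closed_csubspace M"
    using assms(1) by (simp add: subspace_in_def)
qed (use assms in \<open>simp_all add: proj_onto_mem proj_onto_orthogonal\<close>)

lemma proj_onto_eq_self_iff:
  assumes "subspace_in M H" "x \<in> H"
  shows "proj_onto H M x = x \<longleftrightarrow> x \<in> M"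
  using proj_onto_mem[OF assms] proj_onto_eqI[OF assms, of x] by auto

lemma cinner_proj_onto_left:
  assumes "subspace_in M H" "x \<in> H" "y \<in> M"
  shows "cinner (proj_onto H M x) y = cinner x y"
  using proj_onto_orthogonal[OF assms] by (simp add: cinner_diff_left)

lemma perp_proj_onto:
  assumes M: "subspace_in M H"
  shows "perp H (proj_onto H M) = proj_onto H (orth_compl H M)"
proof (rule extensionalityI[of _ H])
  have N: "subspace_in (orth_compl H M) H"
    using M closed_csubspace_orth_compl unfolding subspace_in_def orth_compl_def by blast
  show "proj_onto H (orth_compl H M) \<in> extensional H"
    by (rule proj_onto_extensional[OF N])
  show "perp H (proj_onto H M) x = proj_onto H (orth_compl H M) x" if x: "x \<in> H" for x
  proof -
    have "x - proj_onto H M x \<in> orth_compl H M"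
      using M x proj_onto_mem[OF M x] proj_onto_orthogonal[OF M x] closed_csubspaceD(3)[of H]
      by (auto simp: subspace_in_def orth_compl_def)
    moreover have "cinner (x - (x - proj_onto H M x)) y = 0" if "y \<in> orth_compl H M" for y
      using that proj_onto_mem[OF M x] by (simp add: orth_compl_def cinner_zero_commute[of _ y])
    ultimately show ?thesis
      using proj_onto_eqI[OF N x] x by (simp add: perp_def)
  qed
qed (simp add: perp_def)

lemma orthogonal_projections_iff:
  assumes M: "subspace_in M H" and N: "subspace_in N H"
  shows "orthogonal_projections H (proj_onto H M) (proj_onto H N) \<longleftrightarrow> orthogonal_sets M N"
proof -
  have NH: "N \<subseteq> H"
    using N by (simp add: subspace_in_def)
  have "orthogonal_projections H (proj_onto H M) (proj_onto H N)
      \<longleftrightarrow> (\<forall>x\<in>H. proj_onto H M (proj_onto H N x) = 0)"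
    unfolding orthogonal_projections_def compose_def fun_eq_iff by auto
  also have "\<dots> \<longleftrightarrow> (\<forall>n\<in>N. proj_onto H M n = 0)"
    using ball_simps(9)[of "proj_onto H N" H "\<lambda>n. proj_onto H M n = 0"]
    by (simp add: proj_onto_image[OF N])
  also have "\<dots> \<longleftrightarrow> (\<forall>n\<in>N. \<forall>m\<in>M. cinner n m = 0)"
  proof -
    have "proj_onto H M n = 0 \<longleftrightarrow> (\<forall>m\<in>M. cinner n m = 0)" if "n \<in> N" for n
    proof
      assume "proj_onto H M n = 0"
      then show "\<forall>m\<in>M. cinner n m = 0"
        using proj_onto_orthogonal[OF M, of n] that NH by auto
    next
      assume "\<forall>m\<in>M. cinner n m = 0"
      then show "proj_onto H M n = 0"
        using M that NH by (intro proj_onto_eqI) (auto simp: subspace_in_def closed_csubspaceD)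
    qed
    then show ?thesis
      by blast
  qed
  finally show ?thesis
    unfolding orthogonal_sets_def using cinner_zero_commute by blast
qed

section \<open>Invariant subspaces\<close>

definition invariant :: "('a \<Rightarrow> 'a) set \<Rightarrow> 'a set \<Rightarrow> bool"
  where "invariant \<X> M \<longleftrightarrow> (\<forall>X\<in>\<X>. \<forall>x\<in>M. X x \<in> M)"

lemma compression_perp_zero_iff:
  assumes M: "subspace_in M H" and X: "\<And>x. x \<in> H \<Longrightarrow> X x \<in> H"
  shows "compose H (perp H (proj_onto H M)) (compose H X (proj_onto H M)) = (\<lambda>x\<in>H. 0)
    \<longleftrightarrow> (\<forall>x\<in>M. X x \<in> M)"
proof -
  have MH: "M \<subseteq> H"
    using M by (simp add: subspace_in_def)
  have "compose H (perp H (proj_onto H M)) (compose H X (proj_onto H M)) = (\<lambda>x\<in>H. 0)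
    \<longleftrightarrow> (\<forall>x\<in>H. perp H (proj_onto H M) (X (proj_onto H M x)) = 0)"
    by (auto simp: fun_eq_iff compose_def)
  also have "\<dots> \<longleftrightarrow> (\<forall>m\<in>M. perp H (proj_onto H M) (X m) = 0)"
    using ball_simps(9)[of "proj_onto H M" H "\<lambda>m. perp H (proj_onto H M) (X m) = 0"]
    by (simp add: proj_onto_image[OF M])
  also have "\<dots> \<longleftrightarrow> (\<forall>m\<in>M. X m \<in> M)"
  proof (rule ball_cong[OF refl])
    fix m assume "m \<in> M"
    then have "X m \<in> H"
      using X MH by blast
    then show "perp H (proj_onto H M) (X m) = 0 \<longleftrightarrow> X m \<in> M"
      using proj_onto_eq_self_iff[OF M, of "X m"] by (auto simp: perp_def)
  qed
  finally show ?thesis .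
qed

lemma proj_onto_Lat_iff:
  assumes M: "subspace_in M H" and X: "\<X> \<subseteq> H \<rightarrow> H"
  shows "proj_onto H M \<in> Lat H \<X> \<longleftrightarrow> invariant \<X> M"
proof -
  have "compose H (perp H (proj_onto H M)) (compose H T (proj_onto H M)) = (\<lambda>x\<in>H. 0)
      \<longleftrightarrow> (\<forall>x\<in>M. T x \<in> M)" if "T \<in> \<X>" for T
    using that X by (intro compression_perp_zero_iff[OF M]) blast
  then show ?thesis
    using proj_onto_projections[OF M] unfolding Lat_def invariant_def by blast
qed

text \<open>This replaces quantification over the lattice of projections by quantification over
  invariant closed subspaces, so that operator identities become orthogonality relations.\<close>

lemma Lat_eq_image:
  assumes H: "closed_csubspace H" and X: "\<X> \<subseteq> H \<rightarrow> H"
  shows "Lat H \<X> = proj_onto H ` {M. subspace_in M H \<and> invariant \<X> M}"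
proof (intro set_eqI iffI)
  fix L assume L: "L \<in> Lat H \<X>"
  then have "L \<in> projections H"
    by (simp add: Lat_def)
  note * = projections_eq_proj_onto[OF this H]
  then have "invariant \<X> (L ` H)"
    using L proj_onto_Lat_iff[OF *(1) X] by simp
  with * show "L \<in> proj_onto H ` {M. subspace_in M H \<and> invariant \<X> M}"
    by blast
qed (use proj_onto_Lat_iff[OF _ X] in blast)

lemma reflexive_algebra_mem_iff:
  assumes A: "reflexive_algebra UNIV \<A>"
  shows "T \<in> \<A> \<longleftrightarrow> T \<in> bounded_ops UNIV UNIV \<and>
    (\<forall>M. closed_csubspace M \<and> invariant \<A> M \<longrightarrow> (\<forall>x\<in>M. T x \<in> M))"
proof -
  have Lat: "Lat UNIV \<A> = proj_onto UNIV ` {M. closed_csubspace M \<and> invariant \<A> M}"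
    by (subst Lat_eq_image) (simp_all add: closed_csubspace_UNIV)
  have "\<A> = {T \<in> bounded_ops UNIV UNIV.
      \<forall>L\<in>Lat UNIV \<A>. compose UNIV (perp UNIV L) (compose UNIV T L) = (\<lambda>x\<in>UNIV. 0)}"
    using A unfolding reflexive_algebra_def by blast
  then have "T \<in> \<A> \<longleftrightarrow> T \<in> bounded_ops UNIV UNIV \<and>
      (\<forall>L\<in>Lat UNIV \<A>. compose UNIV (perp UNIV L) (compose UNIV T L) = (\<lambda>x\<in>UNIV. 0))"
    by blast
  also have "\<dots> \<longleftrightarrow> T \<in> bounded_ops UNIV UNIV \<and>
      (\<forall>M. closed_csubspace M \<and> invariant \<A> M \<longrightarrow> (\<forall>x\<in>M. T x \<in> M))"
    unfolding Lat by (auto simp: compression_perp_zero_iff)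
  finally show ?thesis .
qed

section \<open>Images of subspaces under families of operators\<close>

text \<open>With \<open>M\<close> the range of \<open>L\<close>, this is the range of the projection that \<open>Map U\<close>
  assigns to \<open>L\<close>; with \<open>M = UNIV\<close> it is the closed span of all the ranges of \<open>U\<close>.\<close>

definition span_image :: "('a \<Rightarrow> 'b::complex_hilbert) set \<Rightarrow> 'a set \<Rightarrow> 'b set"
  where "span_image U M = closed_cspan (\<Union>T\<in>U. T ` M)"

lemma closed_cspan_values: "closed_cspan {T x | T x. T \<in> U \<and> x \<in> M} = span_image U M"
proof -
  have "{T x | T x. T \<in> U \<and> x \<in> M} = (\<Union>T\<in>U. T ` M)"
    by blast
  then show ?thesis
    by (simp add: span_image_def)
qed

lemma closed_span_image: "closed_csubspace (span_image U M)"
  unfolding span_image_def by (rule closed_csubspace_closed_cspan)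

lemma span_image_mem: "T \<in> U \<Longrightarrow> x \<in> M \<Longrightarrow> T x \<in> span_image U M"
  unfolding span_image_def by (rule subsetD[OF closed_cspan_superset]) blast

lemma span_image_subset:
  "closed_csubspace K \<Longrightarrow> (\<And>T. T \<in> U \<Longrightarrow> T ` M \<subseteq> K) \<Longrightarrow> span_image U M \<subseteq> K"
  unfolding span_image_def by (rule closed_cspan_minimal) blast

lemma orthogonal_span_image_left:
  "orthogonal_sets (span_image U M) Y \<longleftrightarrow> (\<forall>T\<in>U. \<forall>x\<in>M. \<forall>y\<in>Y. cinner (T x) y = 0)"
  unfolding span_image_def orthogonal_closed_cspan_left
  unfolding orthogonal_sets_def by blast

lemma orthogonal_span_image_right:
  "orthogonal_sets X (span_image U M) \<longleftrightarrow> (\<forall>x\<in>X. \<forall>T\<in>U. \<forall>m\<in>M. cinner x (T m) = 0)"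
  unfolding span_image_def orthogonal_closed_cspan_right
  unfolding orthogonal_sets_def by blast

lemma op_map_proj_onto:
  assumes "subspace_in M H"
  shows "op_map H K U (proj_onto H M) = proj_onto K (span_image U M)"
  unfolding op_map_def proj_onto_image[OF assms] closed_cspan_values ..

text \<open>Moving \<open>B\<close> to the other side of the inner product leaves a condition that is linear and
  continuous in the vector of \<open>span_image U M\<close>, so testing it on the generators suffices.\<close>

lemma orthogonal_span_image_span_image:
  assumes B: "\<B> \<subseteq> bounded_ops UNIV UNIV"
  shows "orthogonal_sets (span_image \<B> (span_image U M)) (span_image W N) \<longleftrightarrow>
    (\<forall>B\<in>\<B>. \<forall>S\<in>U. \<forall>x\<in>M. \<forall>T\<in>W. \<forall>y\<in>N. cinner (B (S x)) (T y) = 0)"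
proof -
  have adj: "cinner (B x) y = cinner x (adj UNIV UNIV B y)" if "B \<in> \<B>" for B x y
    using that B by (intro cinner_adj[OF _ closed_csubspace_UNIV closed_csubspace_UNIV]) auto
  define Y where "Y = (\<Union>T\<in>W. T ` N)"
  have "orthogonal_sets (span_image \<B> (span_image U M)) (span_image W N) \<longleftrightarrow>
      orthogonal_sets (span_image \<B> (span_image U M)) Y"
    unfolding span_image_def[of W] Y_def[symmetric] by simp
  also have "\<dots> \<longleftrightarrow> (\<forall>B\<in>\<B>. orthogonal_sets (span_image U M) (adj UNIV UNIV B ` Y))"
    unfolding orthogonal_span_image_left[of \<B>] unfolding orthogonal_sets_def ball_simps(9)
    by (intro ball_cong refl) (simp only: adj)
  also have "\<dots> \<longleftrightarrow> (\<forall>B\<in>\<B>. \<forall>S\<in>U. \<forall>x\<in>M. \<forall>y\<in>Y. cinner (B (S x)) y = 0)"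
    unfolding orthogonal_span_image_left ball_simps(9)
    by (intro ball_cong refl) (simp only: adj)
  also have "\<dots> \<longleftrightarrow> (\<forall>B\<in>\<B>. \<forall>S\<in>U. \<forall>x\<in>M. \<forall>T\<in>W. \<forall>y\<in>N. cinner (B (S x)) (T y) = 0)"
    unfolding Y_def by blast
  finally show ?thesis .
qed

text \<open>The residual \<open>v - P\<^sub>I v\<close> is always orthogonal to \<open>I\<close>, so it is orthogonal to the span of
  \<open>I\<close> and \<open>J\<close> if and only if it is orthogonal to \<open>J\<close>, where \<open>P\<^sub>I v\<close> does not contribute.\<close>

lemma residual_orthogonal_iff:
  assumes I: "closed_csubspace I" and K: "K = closed_cspan (I \<union> J)" and IJ: "orthogonal_sets I J"
  shows "orthogonal_sets {v - proj_onto UNIV I v} K \<longleftrightarrow> orthogonal_sets {v} J"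
proof -
  have "cinner (v - proj_onto UNIV I v) y = 0" if "y \<in> I" for y
    using proj_onto_orthogonal[of I UNIV v y] I that by simp
  moreover have "cinner (proj_onto UNIV I v) y = 0" if "y \<in> J" for y
    using orthogonal_setsD[OF IJ proj_onto_mem that] I by simp
  ultimately show ?thesis
    unfolding K orthogonal_closed_cspan_right unfolding orthogonal_sets_def
    by (auto simp: cinner_diff_left)
qed

text \<open>The existence of \<open>Q\<close> says that the vectors of \<open>V\<close> differ from their projections to \<open>I\<close>
  by vectors orthogonal to \<open>K\<close>; \<open>Q\<close> is then the projection onto the part of \<open>V\<close> orthogonal
  to \<open>K\<close>.\<close>

lemma proj_onto_direct_sum_iff:
  assumes I: "closed_csubspace I" and K: "closed_csubspace K" and V: "closed_csubspace V"
    and IK: "I \<subseteq> K" and IV: "I \<subseteq> V"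
  shows "(\<exists>Q\<in>projections (orth_compl UNIV K).
      proj_onto UNIV V = direct_sum UNIV K (restrict (proj_onto UNIV I) K) Q) \<longleftrightarrow>
    (\<forall>v\<in>V. orthogonal_sets {v - proj_onto UNIV I v} K)"
proof
  define C where "C = orth_compl UNIV K"
  have C: "closed_csubspace C"
    unfolding C_def by (rule closed_csubspace_orth_compl[OF closed_csubspace_UNIV])
  have mem_C: "x \<in> C \<longleftrightarrow> orthogonal_sets {x} K" for x
    by (simp add: C_def orth_compl_def orthogonal_sets_def)
  have PK: "proj_onto UNIV K x \<in> K" and PC: "proj_onto UNIV C x \<in> C" for x
    using K C by (simp_all add: proj_onto_mem)
  have ds: "direct_sum UNIV K (restrict (proj_onto UNIV I) K) Q x =
      proj_onto UNIV I (proj_onto UNIV K x) + Q (proj_onto UNIV C x)" for Q x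
    using PK by (simp add: direct_sum_def C_def)
  {
    assume "\<exists>Q\<in>projections (orth_compl UNIV K).
        proj_onto UNIV V = direct_sum UNIV K (restrict (proj_onto UNIV I) K) Q"
    then obtain Q where Q: "Q \<in> projections C"
        "proj_onto UNIV V = direct_sum UNIV K (restrict (proj_onto UNIV I) K) Q"
      unfolding C_def by blast
    show "\<forall>v\<in>V. orthogonal_sets {v - proj_onto UNIV I v} K"
    proof
      fix v assume "v \<in> V"
      define i where "i = proj_onto UNIV I (proj_onto UNIV K v)"
      define q where "q = Q (proj_onto UNIV C v)"
      have "q \<in> C"
        using projections_range(2)[OF Q(1) C] PC by (auto simp: q_def)
      have "i \<in> I"
        using I by (simp add: i_def proj_onto_mem)
      have "proj_onto UNIV V v = v"
        using V \<open>v \<in> V\<close> by (simp add: proj_onto_eq_self_iff)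
      then have v: "v = i + q"
        unfolding Q(2) ds by (simp add: i_def q_def)
      have "proj_onto UNIV I v = i"
        using I IK \<open>i \<in> I\<close> \<open>q \<in> C\<close>
        by (intro proj_onto_eqI) (auto simp: v mem_C orthogonal_sets_def)
      then show "orthogonal_sets {v - proj_onto UNIV I v} K"
        using \<open>q \<in> C\<close> by (simp add: v mem_C)
    qed
  }
  {
    assume res: "\<forall>v\<in>V. orthogonal_sets {v - proj_onto UNIV I v} K"
    have VC: "subspace_in (V \<inter> C) C"
      using V C by (simp add: subspace_in_def closed_csubspace_Int)
    define Q where "Q = proj_onto C (V \<inter> C)"
    have "proj_onto UNIV V x = direct_sum UNIV K (restrict (proj_onto UNIV I) K) Q x" for x
      unfolding ds
    proof (rule proj_onto_eqI)
      define k c where "k = proj_onto UNIV K x" and "c = proj_onto UNIV C x"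
      have kc: "k \<in> K" "c \<in> C"
        by (simp_all add: k_def c_def PK PC)
      have Qc: "Q c \<in> V \<inter> C"
        unfolding Q_def by (rule proj_onto_mem[OF VC \<open>c \<in> C\<close>])
      have Pk: "proj_onto UNIV I k \<in> I"
        using I by (simp add: proj_onto_mem)
      show "proj_onto UNIV I k + Q c \<in> V"
        using Qc Pk IV closed_csubspaceD(2)[OF V] by blast
      have x: "x = k + c"
      proof -
        have "c = perp UNIV (proj_onto UNIV K) x"
          unfolding c_def C_def using K by (simp add: perp_proj_onto)
        then show ?thesis
          by (simp add: k_def perp_def)
      qed
      fix v assume "v \<in> V"
      define i where "i = proj_onto UNIV I v"
      have i: "i \<in> I"
        using I by (simp add: i_def proj_onto_mem)
      have vi: "v - i \<in> V \<inter> C"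
        using res \<open>v \<in> V\<close> i IV closed_csubspaceD(3)[OF V] by (auto simp: i_def mem_C)
      have KC: "cinner y z = 0" if "y \<in> K" "z \<in> C" for y z
        using that cinner_zero_commute[of y z] by (simp add: mem_C orthogonal_sets_def)
      have CK: "cinner z y = 0" if "y \<in> K" "z \<in> C" for y z
        using that by (simp add: mem_C orthogonal_sets_def)
      have "cinner (k - proj_onto UNIV I k) i = 0"
        using I i by (simp add: proj_onto_orthogonal)
      moreover have "cinner (c - Q c) (v - i) = 0"
        unfolding Q_def by (rule proj_onto_orthogonal[OF VC \<open>c \<in> C\<close> vi])
      moreover have "cinner (c - Q c) i = 0"
        using Qc kc i IK closed_csubspaceD(3)[OF C] by (intro CK) auto
      moreover have "cinner (k - proj_onto UNIV I k) (v - i) = 0"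
        using vi kc Pk IK closed_csubspaceD(3)[OF K] by (intro KC) auto
      ultimately show "cinner (x - (proj_onto UNIV I k + Q c)) v = 0"
        unfolding x by (simp add: cinner_simps)
    qed (use V in simp_all)
    moreover have "Q \<in> projections C"
      unfolding Q_def by (rule proj_onto_projections[OF VC])
    ultimately show "\<exists>Q\<in>projections (orth_compl UNIV K).
        proj_onto UNIV V = direct_sum UNIV K (restrict (proj_onto UNIV I) K) Q"
      unfolding C_def by blast
  }
qed

section \<open>Orthogonality form of the semi-normalizer\<close>

text \<open>A vector lies in \<open>M\<close> exactly if it is orthogonal to the orthogonal complement of \<open>M\<close>;
  for the value of \<open>T\<^sup>* B S\<close> at \<open>x\<close> the factor \<open>T\<^sup>*\<close> then moves to the other argument.\<close>

lemma adj_sandwich_mem_iff: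
  assumes A: "reflexive_algebra UNIV \<A>" and B: "B \<in> bounded_ops UNIV UNIV"
    and S: "S \<in> bounded_ops UNIV UNIV" and T: "T \<in> bounded_ops UNIV UNIV"
  shows "compose UNIV (adj UNIV UNIV T) (compose UNIV B S) \<in> \<A> \<longleftrightarrow>
    (\<forall>M. closed_csubspace M \<and> invariant \<A> M \<longrightarrow>
      (\<forall>x\<in>M. \<forall>y\<in>orth_compl UNIV M. cinner (B (S x)) (T y) = 0))"
proof -
  let ?C = "compose UNIV (adj UNIV UNIV T) (compose UNIV B S)"
  note U = closed_csubspace_UNIV
  have "?C \<in> bounded_ops UNIV UNIV"
    by (intro bounded_ops_compose[OF adj_bounded_ops[OF T U U]] bounded_ops_compose[OF B S U] U)
  moreover have "?C x \<in> M \<longleftrightarrow> (\<forall>y\<in>orth_compl UNIV M. cinner (B (S x)) (T y) = 0)"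
    if M: "closed_csubspace M" for M x
  proof -
    have "?C x \<in> M \<longleftrightarrow> ?C x \<in> orth_compl UNIV (orth_compl UNIV M)"
      by (simp add: orth_compl_orth_compl M U)
    also have "\<dots> \<longleftrightarrow> (\<forall>y\<in>orth_compl UNIV M. cinner y (?C x) = 0)"
      by (simp add: orth_compl_def[of _ "orth_compl UNIV M"] cinner_zero_commute[of "?C x"])
    also have "\<dots> \<longleftrightarrow> (\<forall>y\<in>orth_compl UNIV M. cinner (T y) (B (S x)) = 0)"
      by (simp add: compose_def cinner_adj[OF T U U])
    also have "\<dots> \<longleftrightarrow> (\<forall>y\<in>orth_compl UNIV M. cinner (B (S x)) (T y) = 0)"
      by (simp add: cinner_zero_commute[of "T _"])
    finally show ?thesis .
  qed
  ultimately show ?thesis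
    unfolding reflexive_algebra_mem_iff[OF A] by auto
qed

text \<open>By definition \<open>SN\<close> constrains the quadratic expressions \<open>T\<^sup>* B T\<close>; polarization inside
  the linear space \<open>U\<close> extends the constraint to \<open>T\<^sup>* B S\<close>.\<close>

lemma subset_SN_iff:
  assumes A: "reflexive_algebra UNIV \<A>" and B: "\<B> \<subseteq> bounded_ops UNIV UNIV"
    and U: "op_subspace UNIV UNIV U"
  shows "U \<subseteq> SN UNIV UNIV \<B> \<A> \<longleftrightarrow> (\<forall>M. closed_csubspace M \<and> invariant \<A> M \<longrightarrow>
    orthogonal_sets (span_image \<B> (span_image U M)) (span_image U (orth_compl UNIV M)))"
    (is "_ \<longleftrightarrow> ?R")
proof -
  have Ub: "U \<subseteq> bounded_ops UNIV UNIV"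
    using U by (simp add: op_subspace_def)
  have B': "B \<in> bounded_ops UNIV UNIV" if "B \<in> \<B>" for B
    using that B by blast
  have Ub': "T \<in> bounded_ops UNIV UNIV" if "T \<in> U" for T
    using that Ub by blast
  define f where "f B x y S T = cinner (B (S x)) (T y)"
    for B :: "'b \<Rightarrow> 'b" and x y and S T :: "'a \<Rightarrow> 'b"
  have "U \<subseteq> SN UNIV UNIV \<B> \<A> \<longleftrightarrow>
      (\<forall>T\<in>U. \<forall>B\<in>\<B>. compose UNIV (adj UNIV UNIV T) (compose UNIV B T) \<in> \<A>)"
    using Ub by (auto simp: SN_def)
  also have "\<dots> \<longleftrightarrow> (\<forall>M. closed_csubspace M \<and> invariant \<A> M \<longrightarrow>
      (\<forall>B\<in>\<B>. \<forall>x\<in>M. \<forall>y\<in>orth_compl UNIV M. \<forall>T\<in>U. f B x y T T = 0))"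
    (is "?P \<longleftrightarrow> ?Q")
  proof -
    have "?P \<longleftrightarrow> (\<forall>T\<in>U. \<forall>B\<in>\<B>. \<forall>M. closed_csubspace M \<and> invariant \<A> M \<longrightarrow>
        (\<forall>x\<in>M. \<forall>y\<in>orth_compl UNIV M. f B x y T T = 0))"
      unfolding f_def by (intro ball_cong refl adj_sandwich_mem_iff[OF A] B' Ub')
    then show ?thesis
      by blast
  qed
  also have "\<dots> \<longleftrightarrow> (\<forall>M. closed_csubspace M \<and> invariant \<A> M \<longrightarrow>
      (\<forall>B\<in>\<B>. \<forall>x\<in>M. \<forall>y\<in>orth_compl UNIV M. \<forall>S\<in>U. \<forall>T\<in>U. f B x y S T = 0))"
  proof -
    have "(\<forall>T\<in>U. f B x y T T = 0) \<longleftrightarrow> (\<forall>S\<in>U. \<forall>T\<in>U. f B x y S T = 0)" if "B \<in> \<B>" for B x y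
    proof
      assume quad: "\<forall>T\<in>U. f B x y T T = 0"
      note Blin = bounded_opsD[OF B'[OF that]]
      show "\<forall>S\<in>U. \<forall>T\<in>U. f B x y S T = 0"
      proof (intro ballI)
        fix S T assume "S \<in> U" "T \<in> U"
        have sum: "f B x y S T' + f B x y T' S = 0" if "T' \<in> U" for T'
        proof -
          have "(\<lambda>x\<in>UNIV. S x + T' x) \<in> U"
            using U \<open>S \<in> U\<close> that unfolding op_subspace_def by blast
          then have "f B x y (\<lambda>x\<in>UNIV. S x + T' x) (\<lambda>x\<in>UNIV. S x + T' x) = 0"
            using quad by blast
          then show ?thesis
            using quad \<open>S \<in> U\<close> that by (simp add: f_def Blin cinner_simps add.commute)
        qed
        \<comment> \<open>the form is conjugate linear in \<open>T\<close>, so \<open>\<i> T\<close> in place of \<open>T\<close> turns the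
          vanishing sum into a vanishing difference\<close>
        have "(\<lambda>x\<in>UNIV. \<i> *\<^sub>C T x) \<in> U"
          using U \<open>T \<in> U\<close> unfolding op_subspace_def by blast
        from sum[OF this] have "f B x y S T = f B x y T S"
          by (simp add: f_def Blin cinner_simps)
        with sum[OF \<open>T \<in> U\<close>] show "f B x y S T = 0"
          by simp
      qed
    qed blast
    then show ?thesis
      by (simp cong: ball_cong)
  qed
  also have "\<dots> \<longleftrightarrow> ?R"
    unfolding f_def orthogonal_span_image_span_image[OF B] by blast
  finally show ?thesis .
qed

section \<open>The compressed algebras\<close>

lemma span_image_UNIV_split:
  assumes split: "\<And>x. \<exists>m\<in>M. \<exists>n\<in>N. \<forall>T\<in>U. T x = T m + T n"
  shows "span_image U UNIV = closed_cspan (span_image U M \<union> span_image U N)" (is "?L = ?R")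
proof
  note R = closed_csubspace_closed_cspan[of "span_image U M \<union> span_image U N"]
  show "?L \<subseteq> ?R"
  proof (rule span_image_subset[OF R], rule image_subsetI)
    fix T x assume "T \<in> U"
    obtain m n where mn: "m \<in> M" "n \<in> N" "T x = T m + T n"
      using split[of x] \<open>T \<in> U\<close> by blast
    have "T m \<in> ?R" "T n \<in> ?R"
      using span_image_mem[OF \<open>T \<in> U\<close> mn(1)] span_image_mem[OF \<open>T \<in> U\<close> mn(2)]
        closed_cspan_superset[of "span_image U M \<union> span_image U N"] by blast+
    then show "T x \<in> ?R"
      unfolding mn(3) by (rule closed_csubspaceD(2)[OF R])
  qed
  have "span_image U X \<subseteq> ?L" for X
    unfolding span_image_def by (intro closed_cspan_mono) blast
  then show "?R \<subseteq> ?L"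
    by (intro closed_cspan_minimal closed_span_image Un_least)
qed

lemma span_image_complement_split:
  assumes U: "U \<subseteq> bounded_ops UNIV UNIV" and M: "closed_csubspace M"
  shows "span_image U UNIV =
    closed_cspan (span_image U M \<union> span_image U (orth_compl UNIV M))"
proof (rule span_image_UNIV_split)
  fix x
  let ?m = "proj_onto UNIV M x"
  have "x - ?m \<in> orth_compl UNIV M"
    using M by (simp add: orth_compl_def proj_onto_orthogonal)
  moreover have "?m \<in> M"
    using M by (simp add: proj_onto_mem)
  moreover have "T x = T ?m + T (x - ?m)" if "T \<in> U" for T
    using that U bounded_ops_diff[of T UNIV x ?m] by auto
  ultimately show "\<exists>m\<in>M. \<exists>n\<in>orth_compl UNIV M. \<forall>T\<in>U. T x = T m + T n"
    by blast
qed

text \<open>As \<open>T\<^sup>*\<close> moves across the inner product, a vector is orthogonal to the ranges of the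
  adjoints if and only if the operators of \<open>U\<close> annihilate it.\<close>

lemma orth_compl_coinitial_iff:
  assumes U: "U \<subseteq> bounded_ops UNIV UNIV"
  shows "x \<in> orth_compl UNIV (span_image (adj UNIV UNIV ` U) UNIV) \<longleftrightarrow> (\<forall>T\<in>U. T x = 0)"
proof -
  have "x \<in> orth_compl UNIV (span_image (adj UNIV UNIV ` U) UNIV) \<longleftrightarrow>
      orthogonal_sets {x} (span_image (adj UNIV UNIV ` U) UNIV)"
    by (simp add: orth_compl_def orthogonal_sets_def)
  also have "\<dots> \<longleftrightarrow> (\<forall>T\<in>U. \<forall>y. cinner x (adj UNIV UNIV T y) = 0)"
    unfolding orthogonal_span_image_right by simp
  also have "\<dots> \<longleftrightarrow> (\<forall>T\<in>U. \<forall>y. cinner (T x) y = 0)"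
  proof (intro ball_cong refl)
    fix T assume "T \<in> U"
    then have "T \<in> bounded_ops UNIV UNIV"
      using U by blast
    from cinner_adj[OF this closed_csubspace_UNIV closed_csubspace_UNIV, of x]
    show "(\<forall>y. cinner x (adj UNIV UNIV T y) = 0) \<longleftrightarrow> (\<forall>y. cinner (T x) y = 0)"
      by simp
  qed
  also have "\<dots> \<longleftrightarrow> (\<forall>T\<in>U. T x = 0)"
    by (metis cinner_self_eq_0 cinner_zero_left)
  finally show ?thesis .
qed

lemma apply_proj_onto_coinitial:
  assumes U: "U \<subseteq> bounded_ops UNIV UNIV" and T: "T \<in> U"
    and K1: "K\<^sub>1 = span_image (adj UNIV UNIV ` U) UNIV"
  shows "T (proj_onto UNIV K\<^sub>1 x) = T x"
proof -
  have K: "subspace_in K\<^sub>1 UNIV"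
    by (simp add: K1 closed_span_image)
  have "x - proj_onto UNIV K\<^sub>1 x \<in> orth_compl UNIV K\<^sub>1"
    using proj_onto_orthogonal[OF K] by (simp add: orth_compl_def)
  then have "T (x - proj_onto UNIV K\<^sub>1 x) = 0"
    using T unfolding K1 orth_compl_coinitial_iff[OF U] by blast
  then show ?thesis
    using bounded_ops_diff[of T UNIV x] T U by auto
qed

text \<open>The invariant subspaces \<open>N\<close> of the compression of \<open>\<A>\<close> need not come from invariant
  subspaces of \<open>\<A>\<close>, so the orthogonality form of the semi-normalizer does not apply to
  them directly. Instead the operators \<open>T\<^sup>* B S\<close> are elements of \<open>\<A>\<close>, and the invariance of
  \<open>N\<close> under their compressions makes \<open>B\<close> map \<open>U N\<close> into the orthogonal complement of
  \<open>U (K\<^sub>1 \<ominus> N)\<close>. As \<open>K\<^sub>2\<close> is spanned by \<open>U N\<close> and \<open>U (K\<^sub>1 \<ominus> N)\<close>, the projection of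
  \<open>B y\<close> to \<open>K\<^sub>2\<close> has no component outside \<open>U N\<close>.\<close>

lemma compression_invariant_span_image:
  assumes A: "reflexive_algebra UNIV \<A>" and B: "reflexive_algebra UNIV \<B>"
    and U: "op_subspace UNIV UNIV U" and SN: "U \<subseteq> SN UNIV UNIV \<B> \<A>"
    and K1: "K\<^sub>1 = span_image (adj UNIV UNIV ` U) UNIV" and K2: "K\<^sub>2 = span_image U UNIV"
    and N: "closed_csubspace N" "N \<subseteq> K\<^sub>1"
    and inv: "\<forall>A\<in>\<A>. \<forall>x\<in>N. proj_onto UNIV K\<^sub>1 (A x) \<in> N"
  shows "\<forall>B\<in>\<B>. \<forall>y\<in>span_image U N. proj_onto UNIV K\<^sub>2 (B y) \<in> span_image U N"
proof -
  note UN = closed_csubspace_UNIV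
  have Bb: "\<B> \<subseteq> bounded_ops UNIV UNIV" and one: "(\<lambda>x\<in>UNIV. x) \<in> \<B>"
    using B by (auto simp: reflexive_algebra_def unital_algebra_def op_subspace_def)
  have Ub: "U \<subseteq> bounded_ops UNIV UNIV"
    using U by (simp add: op_subspace_def)
  have K: "closed_csubspace K\<^sub>1" "closed_csubspace K\<^sub>2"
    by (simp_all add: K1 K2 closed_span_image)
  define W where "W = orth_compl K\<^sub>1 N"
  define I where "I = span_image U N"
  define J where "J = span_image U W"
  have sandwich: "compose UNIV (adj UNIV UNIV T) (compose UNIV B S) \<in> \<A>"
    if "S \<in> U" "T \<in> U" "B \<in> \<B>" for S T B
  proof -
    have "\<forall>M. closed_csubspace M \<and> invariant \<A> M \<longrightarrow>
        orthogonal_sets (span_image \<B> (span_image U M)) (span_image U (orth_compl UNIV M))"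
      using SN unfolding subset_SN_iff[OF A Bb U] .
    moreover have "B \<in> bounded_ops UNIV UNIV" "S \<in> bounded_ops UNIV UNIV" "T \<in> bounded_ops UNIV UNIV"
      using that Bb Ub by blast+
    ultimately show ?thesis
      using that unfolding adj_sandwich_mem_iff[OF A \<open>B \<in> bounded_ops UNIV UNIV\<close>
          \<open>S \<in> bounded_ops UNIV UNIV\<close> \<open>T \<in> bounded_ops UNIV UNIV\<close>]
        orthogonal_span_image_span_image[OF Bb] by blast
  qed
  have "cinner (B (S x)) (T y) = 0" if "B \<in> \<B>" "S \<in> U" "x \<in> N" "T \<in> U" "y \<in> W" for B S x T y
  proof -
    let ?z = "adj UNIV UNIV T (B (S x))"
    have "y \<in> K\<^sub>1"
      using \<open>y \<in> W\<close> by (simp add: W_def orth_compl_def)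
    have T: "T \<in> bounded_ops UNIV UNIV"
      using that Ub by blast
    have "proj_onto UNIV K\<^sub>1 ?z \<in> N"
      using inv sandwich[OF \<open>S \<in> U\<close> \<open>T \<in> U\<close> \<open>B \<in> \<B>\<close>] \<open>x \<in> N\<close> by (force simp: compose_def)
    then have "cinner y (proj_onto UNIV K\<^sub>1 ?z) = 0"
      using \<open>y \<in> W\<close> by (simp add: W_def orth_compl_def)
    moreover have "cinner (proj_onto UNIV K\<^sub>1 ?z) y = cinner ?z y"
      using K \<open>y \<in> K\<^sub>1\<close> by (intro cinner_proj_onto_left) simp_all
    ultimately have "cinner y ?z = 0"
      by (simp add: cinner_zero_commute[of y])
    then have "cinner (T y) (B (S x)) = 0"
      by (simp add: cinner_adj[OF T UN UN])
    then show ?thesis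
      by (simp add: cinner_zero_commute[of "B (S x)"])
  qed
  then have VJ: "orthogonal_sets (span_image \<B> I) J"
    unfolding I_def J_def orthogonal_span_image_span_image[OF Bb] by blast
  have "I \<subseteq> span_image \<B> I"
    using span_image_mem[OF one] by auto
  then have IJ: "orthogonal_sets I J"
    using VJ unfolding orthogonal_sets_def by blast
  have split: "K\<^sub>2 = closed_cspan (I \<union> J)"
    unfolding K2 I_def J_def
  proof (rule span_image_UNIV_split)
    fix x
    let ?k = "proj_onto UNIV K\<^sub>1 x"
    let ?m = "proj_onto UNIV N ?k"
    have "?k \<in> K\<^sub>1" "?m \<in> N"
      using K N by (simp_all add: proj_onto_mem)
    moreover have "?k - ?m \<in> W"
      unfolding W_def orth_compl_def
      using N K \<open>?k \<in> K\<^sub>1\<close> \<open>?m \<in> N\<close> by (auto simp: proj_onto_orthogonal intro: closed_csubspaceD(3))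
    moreover have "T x = T ?m + T (?k - ?m)" if "T \<in> U" for T
      using that Ub bounded_ops_diff[of T UNIV ?k ?m] apply_proj_onto_coinitial[OF Ub that K1] by auto
    ultimately show "\<exists>m\<in>N. \<exists>n\<in>W. \<forall>T\<in>U. T x = T m + T n"
      by blast
  qed
  have "proj_onto UNIV K\<^sub>2 (B y) \<in> I" if "B \<in> \<B>" "y \<in> I" for B y
  proof -
    have I: "closed_csubspace I" "I \<subseteq> K\<^sub>2"
      using closed_cspan_superset[of "I \<union> J"] by (simp_all add: I_def closed_span_image split)
    have "orthogonal_sets {B y} J"
      using VJ span_image_mem[OF that] unfolding orthogonal_sets_def by blast
    then have "orthogonal_sets {B y - proj_onto UNIV I (B y)} K\<^sub>2"
      using residual_orthogonal_iff[OF I(1) split IJ] by blast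
    moreover have mem: "proj_onto UNIV I (B y) \<in> I"
      using I by (simp add: proj_onto_mem)
    ultimately have "proj_onto UNIV K\<^sub>2 (B y) = proj_onto UNIV I (B y)"
      using K I by (intro proj_onto_eqI) (auto simp: orthogonal_sets_def)
    then show ?thesis
      using mem by simp
  qed
  then show ?thesis
    unfolding I_def by blast
qed

text \<open>If the common kernel of \<open>U\<close> contains \<open>w\<close>, then it contains the components of \<open>w\<close>
  in \<open>M\<close> and in its orthogonal complement: the images of the two components under
  \<open>T \<in> U\<close> are orthogonal by assumption and add up to zero. Hence the common kernel, and with it
  \<open>K\<^sub>1\<close>, reduces \<open>M\<close>. In this way the orthogonality condition makes the intersection of
  \<open>M\<close> with \<open>K\<^sub>1\<close> large enough to have the same image as \<open>M\<close>.\<close>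

lemma coinitial_reduces:
  assumes U: "U \<subseteq> bounded_ops UNIV UNIV"
    and K1: "K\<^sub>1 = span_image (adj UNIV UNIV ` U) UNIV" and M: "closed_csubspace M"
    and orth: "orthogonal_sets (span_image U M) (span_image U (orth_compl UNIV M))"
    and m: "m \<in> M"
  shows "proj_onto UNIV K\<^sub>1 m \<in> M"
proof -
  have K: "subspace_in K\<^sub>1 UNIV"
    by (simp add: K1 closed_span_image)
  have M': "subspace_in M UNIV"
    using M by simp
  define w where "w = m - proj_onto UNIV K\<^sub>1 m"
  define p where "p = proj_onto UNIV M w"
  have p: "p \<in> M" "w - p \<in> orth_compl UNIV M"
    unfolding p_def using proj_onto_mem[OF M'] proj_onto_orthogonal[OF M']
    by (simp_all add: orth_compl_def)
  have "w - p \<in> orth_compl UNIV K\<^sub>1"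
    unfolding K1 orth_compl_coinitial_iff[OF U]
  proof
    fix T assume T: "T \<in> U"
    then have Tb: "T \<in> bounded_ops UNIV UNIV"
      using U by blast
    have "T w = 0"
      using apply_proj_onto_coinitial[OF U T K1] by (simp add: w_def bounded_ops_diff[OF Tb])
    then have "T p = - T (w - p)"
      by (simp add: bounded_ops_diff[OF Tb])
    moreover have "cinner (T p) (T (w - p)) = 0"
      by (rule orthogonal_setsD[OF orth span_image_mem[OF T p(1)] span_image_mem[OF T p(2)]])
    ultimately have "cinner (T (w - p)) (- T (w - p)) = 0"
      by (simp add: cinner_zero_commute[of "T (w - p)"])
    then show "T (w - p) = 0"
      by (simp add: cinner_minus_right)
  qed
  then have "cinner (w - p) (proj_onto UNIV K\<^sub>1 m) = 0"
    using proj_onto_mem[OF K] by (simp add: orth_compl_def)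
  moreover have "cinner (w - p) m = 0" "cinner (w - p) p = 0"
    using p m by (simp_all add: orth_compl_def)
  ultimately have "cinner (w - p) (w - p) = 0"
    by (simp add: w_def cinner_diff_right[of _ _ p] cinner_diff_right[of _ m])
  then have "w \<in> M"
    using p by simp
  then show ?thesis
    using closed_csubspaceD(3)[OF M m, of w] by (simp add: w_def)
qed

text \<open>For a single subspace \<open>M\<close> this is already the equivalence of the first and the third
  condition. Orthogonality of \<open>\<B> U M\<close> to \<open>U M\<^sup>\<bottom>\<close> contains that of \<open>U M\<close> because \<open>\<B>\<close> is
  unital, and given the latter it says that the residuals are orthogonal to \<open>K\<^sub>2\<close>.\<close>

lemma orthogonal_iff_direct_sum:
  assumes Bb: "\<B> \<subseteq> bounded_ops UNIV UNIV" and one: "(\<lambda>x\<in>UNIV. x) \<in> \<B>"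
    and U: "U \<subseteq> bounded_ops UNIV UNIV" and M: "closed_csubspace M"
    and K2: "K\<^sub>2 = span_image U UNIV"
  shows "orthogonal_sets (span_image \<B> (span_image U M)) (span_image U (orth_compl UNIV M)) \<longleftrightarrow>
    orthogonal_sets (span_image U M) (span_image U (orth_compl UNIV M)) \<and>
    (\<exists>Q\<in>projections (orth_compl UNIV K\<^sub>2). proj_onto UNIV (span_image \<B> (span_image U M)) =
      direct_sum UNIV K\<^sub>2 (restrict (proj_onto UNIV (span_image U M)) K\<^sub>2) Q)"
proof -
  define I where "I = span_image U M"
  define J where "J = span_image U (orth_compl UNIV M)"
  define V where "V = span_image \<B> I"
  have closed: "closed_csubspace I" "closed_csubspace V" "closed_csubspace K\<^sub>2"
    by (simp_all add: I_def V_def K2 closed_span_image)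
  have K2_eq: "K\<^sub>2 = closed_cspan (I \<union> J)"
    unfolding K2 I_def J_def by (rule span_image_complement_split[OF U M])
  have "I \<subseteq> K\<^sub>2"
    using closed_cspan_superset[of "I \<union> J"] by (simp add: K2_eq)
  have "I \<subseteq> V"
    using span_image_mem[OF one] by (auto simp: V_def)
  have "orthogonal_sets V J \<longleftrightarrow> orthogonal_sets I J \<and> (\<forall>v\<in>V. orthogonal_sets {v} J)"
    using \<open>I \<subseteq> V\<close> unfolding orthogonal_sets_def by blast
  also have "\<dots> \<longleftrightarrow> orthogonal_sets I J \<and> (\<forall>v\<in>V. orthogonal_sets {v - proj_onto UNIV I v} K\<^sub>2)"
    using residual_orthogonal_iff[OF closed(1) K2_eq] by blast
  also have "\<dots> \<longleftrightarrow> orthogonal_sets I J \<and> (\<exists>Q\<in>projections (orth_compl UNIV K\<^sub>2).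
      proj_onto UNIV V = direct_sum UNIV K\<^sub>2 (restrict (proj_onto UNIV I) K\<^sub>2) Q)"
    unfolding proj_onto_direct_sum_iff[OF closed(1,3,2) \<open>I \<subseteq> K\<^sub>2\<close> \<open>I \<subseteq> V\<close>] ..
  finally show ?thesis
    unfolding I_def J_def V_def .
qed

section \<open>The equivalence\<close>

lemma invariant_compression_iff:
  assumes "N \<subseteq> K"
  shows "invariant (compression H K ` \<X>) N \<longleftrightarrow> (\<forall>X\<in>\<X>. \<forall>x\<in>N. proj_onto H K (X x) \<in> N)"
proof -
  have "compression H K X x = proj_onto H K (X x)" if "x \<in> N" for X x
    using that assms by (auto simp: compression_def)
  then show ?thesis
    unfolding invariant_def by simp
qed

lemma compression_funcset:
  assumes "closed_csubspace K"
  shows "compression UNIV K ` \<X> \<subseteq> K \<rightarrow> K"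
  using assms by (auto simp: compression_def proj_onto_mem)

theorem theorem5p6:
  fixes \<A> :: "('a::separable_complex_hilbert \<Rightarrow> 'a) set"
    and \<B> :: "('b::separable_complex_hilbert \<Rightarrow> 'b) set"
    and U :: "('a \<Rightarrow> 'b) set"
    and H\<^sub>1 :: "'a set" and H\<^sub>2 :: "'b set"
    and K\<^sub>1 :: "'a set" and K\<^sub>2 :: "'b set"
    and \<A>\<^sub>o :: "('a \<Rightarrow> 'a) set" and \<B>\<^sub>o :: "('b \<Rightarrow> 'b) set" and U\<^sub>o :: "('a \<Rightarrow> 'b) set"
    and chi chi\<^sub>o :: "('a \<Rightarrow> 'a) \<Rightarrow> ('b \<Rightarrow> 'b)"
  assumes H1: "H\<^sub>1 = UNIV" and H2: "H\<^sub>2 = UNIV"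
    and A: "reflexive_algebra H\<^sub>1 \<A>" and B: "reflexive_algebra H\<^sub>2 \<B>"
    and U_normalizing: "normalizing H\<^sub>1 H\<^sub>2 U"
    and U_closed: "closedin (wstar_topology H\<^sub>1 H\<^sub>2) U"
    and chi: "chi = op_map H\<^sub>1 H\<^sub>2 U"
    and K1: "K\<^sub>1 = closed_cspan (\<Union>T\<in>U. adj H\<^sub>1 H\<^sub>2 T ` H\<^sub>2)"
    and K2: "K\<^sub>2 = closed_cspan (\<Union>T\<in>U. T ` H\<^sub>1)"
    and Ao: "\<A>\<^sub>o = compression H\<^sub>1 K\<^sub>1 ` \<A>"
    and Bo: "\<B>\<^sub>o = compression H\<^sub>2 K\<^sub>2 ` \<B>"
    and Uo: "U\<^sub>o = (\<lambda>T. restrict T K\<^sub>1) ` U"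
    and chio: "chi\<^sub>o = op_map K\<^sub>1 K\<^sub>2 U\<^sub>o"
  shows "(U \<subseteq> SN H\<^sub>1 H\<^sub>2 \<B> \<A> \<longleftrightarrow>
      (\<forall>L\<in>Lat H\<^sub>1 \<A>. orthogonal_projections H\<^sub>2 (chi L) (chi (perp H\<^sub>1 L))) \<and>
      chi\<^sub>o ` Lat K\<^sub>1 \<A>\<^sub>o \<subseteq> Lat K\<^sub>2 \<B>\<^sub>o) \<and>
    (U \<subseteq> SN H\<^sub>1 H\<^sub>2 \<B> \<A> \<longleftrightarrow>
      (\<forall>L\<in>Lat H\<^sub>1 \<A>. orthogonal_projections H\<^sub>2 (chi L) (chi (perp H\<^sub>1 L))) \<and>
      (\<forall>L\<in>Lat H\<^sub>1 \<A>. \<exists>Q\<in>projections (orth_compl H\<^sub>2 K\<^sub>2).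
        proj_onto H\<^sub>2 (closed_cspan {B y | B y. B \<in> \<B> \<and> y \<in> chi L ` H\<^sub>2}) =
          direct_sum H\<^sub>2 K\<^sub>2 (restrict (chi L) K\<^sub>2) Q))"
proof -
  note UN = closed_csubspace_UNIV
  have U: "op_subspace UNIV UNIV U"
    using U_normalizing by (simp add: H1 H2 normalizing_def)
  then have Ub: "U \<subseteq> bounded_ops UNIV UNIV"
    by (simp add: op_subspace_def)
  have Ar: "reflexive_algebra UNIV \<A>" and Br: "reflexive_algebra UNIV \<B>"
    using A B by (simp_all add: H1 H2)
  have Bb: "\<B> \<subseteq> bounded_ops UNIV UNIV" and one: "(\<lambda>x\<in>UNIV. x) \<in> \<B>"
    using Br by (auto simp: reflexive_algebra_def unital_algebra_def op_subspace_def)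
  have K1_eq: "K\<^sub>1 = span_image (adj UNIV UNIV ` U) UNIV" and K2_eq: "K\<^sub>2 = span_image U UNIV"
    by (simp_all add: K1 K2 H1 H2 span_image_def)
  have K: "closed_csubspace K\<^sub>1" "closed_csubspace K\<^sub>2"
    by (simp_all add: K1_eq K2_eq closed_span_image)
  define Inv where "Inv = {M. closed_csubspace M \<and> invariant \<A> M}"
  have InvD: "closed_csubspace M" if "M \<in> Inv" for M
    using that by (simp add: Inv_def)
  have Lat: "Lat UNIV \<A> = proj_onto UNIV ` Inv"
    unfolding Inv_def by (subst Lat_eq_image) (simp_all add: UN)
  have chi_proj: "chi (proj_onto UNIV M) = proj_onto UNIV (span_image U M)"
    if "closed_csubspace M" for M
    using that by (simp add: chi H1 H2 op_map_proj_onto)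
  define I where "I = span_image U"
  define J where "J M = span_image U (orth_compl UNIV M)" for M
  have closed_I: "closed_csubspace (I M)" for M
    by (simp add: I_def closed_span_image)
  have one_iff: "U \<subseteq> SN UNIV UNIV \<B> \<A> \<longleftrightarrow>
      (\<forall>M\<in>Inv. orthogonal_sets (span_image \<B> (I M)) (J M))"
    unfolding subset_SN_iff[OF Ar Bb U] Inv_def I_def J_def by simp
  have orth_iff: "(\<forall>L\<in>Lat UNIV \<A>. orthogonal_projections UNIV (chi L) (chi (perp UNIV L))) \<longleftrightarrow>
      (\<forall>M\<in>Inv. orthogonal_sets (I M) (J M))"
  proof -
    have "orthogonal_projections UNIV (chi (proj_onto UNIV M)) (chi (perp UNIV (proj_onto UNIV M)))
        \<longleftrightarrow> orthogonal_sets (I M) (J M)" if "M \<in> Inv" for M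
      using InvD[OF that] closed_csubspace_orth_compl[OF UN, of M]
      by (simp add: perp_proj_onto chi_proj orthogonal_projections_iff closed_span_image I_def J_def)
    then show ?thesis
      unfolding Lat by simp
  qed
  have sum_iff: "(\<forall>L\<in>Lat UNIV \<A>. \<exists>Q\<in>projections (orth_compl UNIV K\<^sub>2).
        proj_onto UNIV (closed_cspan {B y | B y. B \<in> \<B> \<and> y \<in> chi L ` UNIV}) =
          direct_sum UNIV K\<^sub>2 (restrict (chi L) K\<^sub>2) Q) \<longleftrightarrow>
      (\<forall>M\<in>Inv. \<exists>Q\<in>projections (orth_compl UNIV K\<^sub>2). proj_onto UNIV (span_image \<B> (I M)) =
          direct_sum UNIV K\<^sub>2 (restrict (proj_onto UNIV (I M)) K\<^sub>2) Q)"
    unfolding Lat ball_simps(9) closed_cspan_values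
    by (intro ball_cong refl) (simp add: chi_proj InvD proj_onto_image closed_span_image I_def)
  have Uo_image: "span_image U\<^sub>o N = I N" if "N \<subseteq> K\<^sub>1" for N
  proof -
    have "restrict T K\<^sub>1 ` N = T ` N" for T :: "'a \<Rightarrow> 'b"
      using that by (auto intro!: image_cong)
    then show ?thesis
      by (simp add: Uo I_def span_image_def)
  qed
  have I_K2: "I N \<subseteq> K\<^sub>2" for N
    unfolding I_def K2_eq span_image_def by (intro closed_cspan_mono) blast
  have two_iff: "chi\<^sub>o ` Lat K\<^sub>1 \<A>\<^sub>o \<subseteq> Lat K\<^sub>2 \<B>\<^sub>o \<longleftrightarrow>
      (\<forall>N. closed_csubspace N \<and> N \<subseteq> K\<^sub>1 \<and> (\<forall>A\<in>\<A>. \<forall>x\<in>N. proj_onto UNIV K\<^sub>1 (A x) \<in> N) \<longrightarrow>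
        (\<forall>B\<in>\<B>. \<forall>y\<in>I N. proj_onto UNIV K\<^sub>2 (B y) \<in> I N))"
  proof -
    have Lat_o: "Lat K\<^sub>1 \<A>\<^sub>o = proj_onto K\<^sub>1 ` {N. subspace_in N K\<^sub>1 \<and> invariant \<A>\<^sub>o N}"
      using K by (intro Lat_eq_image) (simp_all add: Ao H1 compression_funcset)
    have "chi\<^sub>o (proj_onto K\<^sub>1 N) \<in> Lat K\<^sub>2 \<B>\<^sub>o \<longleftrightarrow> invariant \<B>\<^sub>o (I N)"
      if "subspace_in N K\<^sub>1" for N
    proof -
      have "chi\<^sub>o (proj_onto K\<^sub>1 N) = proj_onto K\<^sub>2 (I N)"
        using that by (simp add: chio op_map_proj_onto Uo_image subspace_in_def)
      moreover have "subspace_in (I N) K\<^sub>2"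
        using K I_K2 closed_I by (simp add: subspace_in_def)
      moreover have "\<B>\<^sub>o \<subseteq> K\<^sub>2 \<rightarrow> K\<^sub>2"
        using K by (simp add: Bo H2 compression_funcset)
      ultimately show ?thesis
        by (simp add: proj_onto_Lat_iff)
    qed
    then have "chi\<^sub>o ` Lat K\<^sub>1 \<A>\<^sub>o \<subseteq> Lat K\<^sub>2 \<B>\<^sub>o \<longleftrightarrow>
        (\<forall>N. subspace_in N K\<^sub>1 \<and> invariant \<A>\<^sub>o N \<longrightarrow> invariant \<B>\<^sub>o (I N))"
      unfolding Lat_o image_subset_iff ball_simps(9) by simp
    also have "\<dots> \<longleftrightarrow> (\<forall>N. closed_csubspace N \<and> N \<subseteq> K\<^sub>1 \<and> invariant \<A>\<^sub>o N \<longrightarrow> invariant \<B>\<^sub>o (I N))"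
      using K by (auto simp: subspace_in_def)
    also have "\<dots> \<longleftrightarrow> (\<forall>N. closed_csubspace N \<and> N \<subseteq> K\<^sub>1 \<and>
        (\<forall>A\<in>\<A>. \<forall>x\<in>N. proj_onto UNIV K\<^sub>1 (A x) \<in> N) \<longrightarrow>
        (\<forall>B\<in>\<B>. \<forall>y\<in>I N. proj_onto UNIV K\<^sub>2 (B y) \<in> I N))"
      unfolding Ao Bo H1 H2 invariant_compression_iff[OF I_K2]
      by (simp add: invariant_compression_iff cong: conj_cong)
    finally show ?thesis .
  qed
  have one_three: "U \<subseteq> SN UNIV UNIV \<B> \<A> \<longleftrightarrow> (\<forall>M\<in>Inv. orthogonal_sets (I M) (J M)) \<and>
      (\<forall>M\<in>Inv. \<exists>Q\<in>projections (orth_compl UNIV K\<^sub>2). proj_onto UNIV (span_image \<B> (I M)) =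
          direct_sum UNIV K\<^sub>2 (restrict (proj_onto UNIV (I M)) K\<^sub>2) Q)"
    unfolding one_iff ball_conj_distrib[symmetric] unfolding I_def J_def
    by (intro ball_cong refl orthogonal_iff_direct_sum[OF Bb one Ub InvD K2_eq])
  have one_two: "U \<subseteq> SN UNIV UNIV \<B> \<A> \<longleftrightarrow>
      (\<forall>M\<in>Inv. orthogonal_sets (I M) (J M)) \<and> chi\<^sub>o ` Lat K\<^sub>1 \<A>\<^sub>o \<subseteq> Lat K\<^sub>2 \<B>\<^sub>o"
  proof (intro iffI conjI)
    assume SN: "U \<subseteq> SN UNIV UNIV \<B> \<A>"
    then show "\<forall>M\<in>Inv. orthogonal_sets (I M) (J M)"
      using one_three by blast
    show "chi\<^sub>o ` Lat K\<^sub>1 \<A>\<^sub>o \<subseteq> Lat K\<^sub>2 \<B>\<^sub>o"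
      unfolding two_iff unfolding I_def
    proof (intro allI impI)
      fix N
      assume "closed_csubspace N \<and> N \<subseteq> K\<^sub>1 \<and> (\<forall>A\<in>\<A>. \<forall>x\<in>N. proj_onto UNIV K\<^sub>1 (A x) \<in> N)"
      then show "\<forall>B\<in>\<B>. \<forall>y\<in>span_image U N. proj_onto UNIV K\<^sub>2 (B y) \<in> span_image U N"
        by (elim conjE) (rule compression_invariant_span_image[OF Ar Br U SN K1_eq K2_eq])
    qed
  next
    assume "(\<forall>M\<in>Inv. orthogonal_sets (I M) (J M)) \<and> chi\<^sub>o ` Lat K\<^sub>1 \<A>\<^sub>o \<subseteq> Lat K\<^sub>2 \<B>\<^sub>o"
    then have IJ: "\<And>M. M \<in> Inv \<Longrightarrow> orthogonal_sets (I M) (J M)"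
      and two: "\<forall>N. closed_csubspace N \<and> N \<subseteq> K\<^sub>1 \<and>
        (\<forall>A\<in>\<A>. \<forall>x\<in>N. proj_onto UNIV K\<^sub>1 (A x) \<in> N) \<longrightarrow>
        (\<forall>B\<in>\<B>. \<forall>y\<in>I N. proj_onto UNIV K\<^sub>2 (B y) \<in> I N)"
      unfolding two_iff by simp_all
    show "U \<subseteq> SN UNIV UNIV \<B> \<A>"
      unfolding one_iff
    proof
      fix M assume M: "M \<in> Inv"
      \<comment> \<open>\<open>M \<inter> K\<^sub>1\<close> is invariant under the compressed algebra and has the same image as
        \<open>M\<close>, so the hypothesis on the compressed lattices controls \<open>\<B> U M\<close>\<close>
      have reduces: "proj_onto UNIV K\<^sub>1 m \<in> M \<inter> K\<^sub>1" if "m \<in> M" for m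
        using coinitial_reduces[OF Ub K1_eq InvD[OF M] _ that] IJ[OF M] K
        by (simp add: I_def J_def proj_onto_mem)
      have I_eq: "I (M \<inter> K\<^sub>1) = I M"
      proof
        show "I (M \<inter> K\<^sub>1) \<subseteq> I M"
          unfolding I_def span_image_def by (intro closed_cspan_mono) blast
        show "I M \<subseteq> I (M \<inter> K\<^sub>1)"
          unfolding I_def
        proof (intro span_image_subset closed_span_image image_subsetI)
          fix T m assume "T \<in> U" "m \<in> M"
          then show "T m \<in> span_image U (M \<inter> K\<^sub>1)"
            using span_image_mem[OF \<open>T \<in> U\<close> reduces[OF \<open>m \<in> M\<close>]]
            by (simp add: apply_proj_onto_coinitial[OF Ub _ K1_eq])
        qed
      qed
      have "\<forall>A\<in>\<A>. \<forall>x\<in>M \<inter> K\<^sub>1. proj_onto UNIV K\<^sub>1 (A x) \<in> M \<inter> K\<^sub>1"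
      proof (intro ballI reduces)
        show "A x \<in> M" if "A \<in> \<A>" "x \<in> M \<inter> K\<^sub>1" for A x
          using M that by (simp add: Inv_def invariant_def)
      qed
      moreover have "closed_csubspace (M \<inter> K\<^sub>1)"
        using InvD[OF M] K by (simp add: closed_csubspace_Int)
      ultimately have "\<forall>B\<in>\<B>. \<forall>y\<in>I (M \<inter> K\<^sub>1). proj_onto UNIV K\<^sub>2 (B y) \<in> I (M \<inter> K\<^sub>1)"
        using two[THEN spec, of "M \<inter> K\<^sub>1"] by simp
      then have inv: "proj_onto UNIV K\<^sub>2 (B y) \<in> I M" if "B \<in> \<B>" "y \<in> I M" for B y
        using that unfolding I_eq by blast
      show "orthogonal_sets (span_image \<B> (I M)) (J M)"
        unfolding orthogonal_span_image_left
      proof (intro ballI)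
        fix B y z assume "B \<in> \<B>" "y \<in> I M" "z \<in> J M"
        have "z \<in> K\<^sub>2"
          using \<open>z \<in> J M\<close> I_K2 unfolding I_def J_def by blast
        then have "cinner (B y) z = cinner (proj_onto UNIV K\<^sub>2 (B y)) z"
          using K by (simp add: cinner_proj_onto_left)
        also have "\<dots> = 0"
          by (rule orthogonal_setsD[OF IJ[OF M] inv[OF \<open>B \<in> \<B>\<close> \<open>y \<in> I M\<close>] \<open>z \<in> J M\<close>])
        finally show "cinner (B y) z = 0" .
      qed
    qed
  qed
  show ?thesis
    unfolding H1 H2 orth_iff sum_iff by (rule conjI[OF one_two one_three])
qed

end
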